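(* Let $\mathbb{X}$ be a Cartesian closed left additive category with a closed system of linearizing combinators $\mathsf{L}^C$. Then: (i) the induced linearizing combinator $\mathsf{L}$ on $\mathbb{X}$, given by $\mathsf{L}[f]:=\langle 0,1\rangle\,\mathsf{L}^\top[\pi_1 f]$ for $f:A\to B$ (with $\langle 0,1\rangle:A\to\top\times A$, $\pi_1:\top\times A\to A$), is an exponentiable linearizing combinator, and $\mathsf{L}^C[f] = \lambda^{-1}\left( \mathsf{L}[\lambda(f)] \right)$ for every $f:C\times A\to B$; (ii) the induced differential combinator $\mathsf{D}_\mathsf{L}$, given by $\mathsf{D}_\mathsf{L}[f]:=\mathsf{L}^A[\oplus_A f]$ for $f:A\to B$, satisfies [CD.$\lambda$] (or equivalently [CD.ev]), and $\mathsf{D}_\mathsf{L}[f] = \lambda^{-1}\left( \mathsf{L}[\lambda(\oplus_A f)] \right)$. Therefore, a Cartesian closed left additive category with a closed system of linearizing combinators is a Cartesian closed differential category.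
   Context: Composition is in diagrammatic order: $fg$ means first $f$, then $g$; identities are written $1$. A left additive category is a category whose hom-sets are commutative monoids $(+,0)$ with $f(g+h)=fg+fh$ and $f0=0$. A map $f$ is additive if $0f=0$ and $(g+h)f=gf+hf$ for all $g,h$. A Cartesian left additive category is a left additive category with (chosen) finite products whose projections $\pi_0,\pi_1$ are additive; $\langle -,-\rangle$ is pairing, $f\times g=\langle \pi_0 f,\pi_1 g\rangle$, $\top$ is the terminal object. Put $\oplus_A:=\pi_0+\pi_1:A\times A\to A$; $\tau:=\langle\pi_1,\pi_0\rangle:A\times B\to B\times A$; $\ell_{A,B,C,D}:=\langle 1,0\rangle\times\langle 0,1\rangle: A\times D\to (A\times B)\times(C\times D)$; $c_{A,B,C,D}:=\langle \pi_0\times\pi_0,\pi_1\times\pi_1\rangle:(A\times B)\times(C\times D)\to(A\times C)\times(B\times D)$ (subscripts omitted). In a Cartesian closed category: $[C,A]$ is the internal hom, $\epsilon:C\times[C,A]\to A$ evaluation, $\lambda(f):A\to[C,B]$ the curry of $f:C\times A\to B$ (unique with $(1\times\lambda(f))\epsilon=f$), and $\lambda^{-1}(g)=(1\times g)\epsilon$. For $f:C\to D$, $g:A\to B$ put $[f,g]:=\lambda((f\times 1)\epsilon g):[D,A]\to[C,B]$. Put $\eta:=\lambda(\pi_1):A\to[C,A]$ and $\mu:=\lambda(\langle\pi_0,\epsilon\rangle\epsilon):[C,[C,A]]\to[C,A]$. A Cartesian closed left additive category is a Cartesian left additive category that is Cartesian closed with $\lambda(f+g)=\lambda(f)+\lambda(g)$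 and $\lambda(0)=0$. A differential combinator $\mathsf{D}$ on a Cartesian left additive category is a family of operators $\mathsf{D}:\mathbb{X}(A,B)\to\mathbb{X}(A\times A,B)$ such that: [CD.1] $\mathsf{D}[f+g]=\mathsf{D}[f]+\mathsf{D}[g]$, $\mathsf{D}[0]=0$; [CD.2] $(1\times\oplus_A)\mathsf{D}[f]=(1\times\pi_0)\mathsf{D}[f]+(1\times\pi_1)\mathsf{D}[f]$, $\langle 1,0\rangle\mathsf{D}[f]=0$; [CD.3] $\mathsf{D}[1]=\pi_1$, $\mathsf{D}[\pi_0]=\pi_1\pi_0$, $\mathsf{D}[\pi_1]=\pi_1\pi_1$; [CD.4] $\mathsf{D}[\langle f,g\rangle]=\langle\mathsf{D}[f],\mathsf{D}[g]\rangle$; [CD.5] $\mathsf{D}[fg]=\langle\pi_0 f,\mathsf{D}[f]\rangle\mathsf{D}[g]$; [CD.6] $\ell\,\mathsf{D}[\mathsf{D}[f]]=\mathsf{D}[f]$; [CD.7] $c\,\mathsf{D}[\mathsf{D}[f]]=\mathsf{D}[\mathsf{D}[f]]$. For $f:C\times A\to B$ put $\mathsf{D}^C[f]:=\langle 1\times\pi_0,0\times\pi_1\rangle\mathsf{D}[f]: C\times(A\times A)\to B$. A Cartesian closed differential category is a Cartesian closed left additive category with a differential combinator satisfying [CD.$\lambda$]: $\mathsf{D}[\lambda(f)]=\lambda(\mathsf{D}^C[f])$ for every $f:C\times A\to B$; equivalently (known) [CD.ev]: $\mathsf{D}^C[\epsilon]=(1\times\pi_1)\epsilon$ for every $\epsilon:C\times[C,A]\to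 A$. A linearizing combinator $\mathsf{L}$ on a Cartesian left additive category is a family of operators $\mathsf{L}:\mathbb{X}(A,B)\to\mathbb{X}(A,B)$ such that: [L.1] $\mathsf{L}[f+g]=\mathsf{L}[f]+\mathsf{L}[g]$, $\mathsf{L}[0]=0$; [L.2] $\mathsf{L}[f]$ is additive; [L.3] $\mathsf{L}[1]=1$, $\mathsf{L}[\pi_0]=\pi_0$, $\mathsf{L}[\pi_1]=\pi_1$; [L.4] $\mathsf{L}[\langle f,g\rangle]=\langle\mathsf{L}[f],\mathsf{L}[g]\rangle$; [L.5] $\mathsf{L}[fg]=\mathsf{L}[f]\,\mathsf{L}[(1+0f)g]$; [L.6] $\mathsf{L}[\mathsf{L}[f]]=\mathsf{L}[f]$. It is exponentiable (on a Cartesian closed left additive category) if moreover: [EL.1] $\mathsf{L}[\eta]=\eta$, $\mathsf{L}[\mu]=\mu$; [EL.2] $\mathsf{L}[[f,g]]=[f,\mathsf{L}[g]]$; [EL.3] for every $f:A\times B\to C$, $\mathsf{L}_0[\mathsf{L}_1[f]]=\mathsf{L}_1[\mathsf{L}_0[f]]$, where $\mathsf{L}_0[f]:=\tau\lambda^{-1}(\mathsf{L}[\lambda(\tau f)])$ and $\mathsf{L}_1[f]:=\lambda^{-1}(\mathsf{L}[\lambda(f)])$. A system of linearizing combinators on $\mathbb{X}$ is a family, indexed by objects $C$, of operators $\mathsf{L}^C:\mathbb{X}(C\times A,B)\to\mathbb{X}(C\times A,B)$ such that: [L.1] $\mathsf{L}^{C}[f+g]=\mathsf{L}^{C}[f]+\mathsf{L}^{C}[g]$,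 $\mathsf{L}^{C}[0]=0$; [L.2] $(1\times\oplus_A)\mathsf{L}^{C}[f]=(1\times\pi_0)\mathsf{L}^{C}[f]+(1\times\pi_1)\mathsf{L}^{C}[f]$, $\langle\pi_0,0\rangle\mathsf{L}^{C}[f]=0$; [L.3] $\mathsf{L}^{C}[\pi_1]=\pi_1$, $\mathsf{L}^{C}[\pi_1\pi_0]=\pi_1\pi_0$, $\mathsf{L}^{C}[\pi_1\pi_1]=\pi_1\pi_1$; [L.4] $\mathsf{L}^{C}[\langle f,g\rangle]=\langle\mathsf{L}^{C}[f],\mathsf{L}^{C}[g]\rangle$; [L.5] $\mathsf{L}^{C}[\langle\pi_0,f\rangle g]=\langle\pi_0,\mathsf{L}^{C}[f]\rangle\,\mathsf{L}^{C}[\langle\pi_0,\pi_1+\langle\pi_0,0\rangle f\rangle g]$; [L.6] $\mathsf{L}^{C}[\mathsf{L}^{C}[f]]=\mathsf{L}^{C}[f]$; [L.7] with $\alpha=\langle 1\times\pi_0,\pi_1\pi_1\rangle:C\times(A\times B)\to(C\times A)\times B$ and $\beta=\langle 1\times\pi_1,\pi_1\pi_0\rangle:C\times(A\times B)\to(C\times B)\times A$, and for $f:C\times(A\times B)\to D$, $\mathsf{L}^C_0[f]:=\beta\,\mathsf{L}^{C\times B}[\beta^{-1}f]$, $\mathsf{L}^C_1[f]:=\alpha\,\mathsf{L}^{C\times A}[\alpha^{-1}f]$, one has $\mathsf{L}^C_1[\mathsf{L}^C_0[f]]=\mathsf{L}^C_0[\mathsf{L}^C_1[f]]$; [L.8]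 for every $h:C'\to C$ and $f:C\times A\to B$, $(h\times 1)\mathsf{L}^{C}[f]=\mathsf{L}^{C'}[(h\times 1)f]$. It is closed if moreover [L.$\lambda$]: for every $f:C\times A\to B$, $\mathsf{L}[\lambda(f)]=\lambda(\mathsf{L}^C[f])$, where $\mathsf{L}[g]:=\langle 0,1\rangle\mathsf{L}^\top[\pi_1 g]$. *)

theory Defs
  imports Main
begin

(* Composition is written in diagrammatic order: f \<cdot> g is first f, then g.  An arrow determines its
   source and target.  An object of the form C \<times>\<^sub>o A or C \<Rrightarrow> A need not determine C and A, so
   operations whose meaning depends on such a decomposition take C and A as arguments. *)

section \<open>Categories\<close>

record ('o, 'a) cat =
  Ob :: "'o set"
  Ar :: "'a set"
  src :: "'a \<Rightarrow> 'o"
  tgt :: "'a \<Rightarrow> 'o"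
  idn :: "'o \<Rightarrow> 'a"  ("\<one>\<index>")
  cmp :: "'a \<Rightarrow> 'a \<Rightarrow> 'a"  (infixl "\<cdot>\<index>" 70)

definition hom :: "('o, 'a, 'm) cat_scheme \<Rightarrow> 'o \<Rightarrow> 'o \<Rightarrow> 'a set" where
  "hom X A B = {f \<in> Ar X. src X f = A \<and> tgt X f = B}"

definition inverse_arrow :: "('o, 'a, 'm) cat_scheme \<Rightarrow> 'a \<Rightarrow> 'a" where
  "inverse_arrow X f = (THE g. g \<in> hom X (tgt X f) (src X f) \<and>
     cmp X f g = idn X (src X f) \<and> cmp X g f = idn X (tgt X f))"

locale category =
  fixes X :: "('o, 'a, 'm) cat_scheme" (structure)
  assumes src_Ob: "f \<in> Ar X \<Longrightarrow> src X f \<in> Ob X"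
    and tgt_Ob: "f \<in> Ar X \<Longrightarrow> tgt X f \<in> Ob X"
    and idn_hom: "A \<in> Ob X \<Longrightarrow> \<one> A \<in> hom X A A"
    and cmp_hom: "\<lbrakk>f \<in> hom X A B; g \<in> hom X B C\<rbrakk> \<Longrightarrow> f \<cdot> g \<in> hom X A C"
    and idn_cmp: "f \<in> hom X A B \<Longrightarrow> \<one> A \<cdot> f = f"
    and cmp_idn: "f \<in> hom X A B \<Longrightarrow> f \<cdot> \<one> B = f"
    and cmp_assoc: "\<lbrakk>f \<in> hom X A B; g \<in> hom X B C; h \<in> hom X C D\<rbrakk> \<Longrightarrow> f \<cdot> g \<cdot> h = f \<cdot> (g \<cdot> h)"

section \<open>Left additive categories\<close>

record ('o, 'a) ladd_cat = "('o, 'a) cat" +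
  add :: "'a \<Rightarrow> 'a \<Rightarrow> 'a"  (infixl "\<^bold>+\<index>" 65)
  zer :: "'o \<Rightarrow> 'o \<Rightarrow> 'a"  ("\<zero>\<index>")

locale left_additive_category = category X
  for X :: "('o, 'a, 'm) ladd_cat_scheme" (structure) +
  assumes add_hom: "\<lbrakk>f \<in> hom X A B; g \<in> hom X A B\<rbrakk> \<Longrightarrow> f \<^bold>+ g \<in> hom X A B"
    and zer_hom: "\<lbrakk>A \<in> Ob X; B \<in> Ob X\<rbrakk> \<Longrightarrow> \<zero> A B \<in> hom X A B"
    and add_assoc: "\<lbrakk>f \<in> hom X A B; g \<in> hom X A B; h \<in> hom X A B\<rbrakk>
      \<Longrightarrow> f \<^bold>+ g \<^bold>+ h = f \<^bold>+ (g \<^bold>+ h)"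
    and add_comm: "\<lbrakk>f \<in> hom X A B; g \<in> hom X A B\<rbrakk> \<Longrightarrow> f \<^bold>+ g = g \<^bold>+ f"
    and add_zer: "f \<in> hom X A B \<Longrightarrow> f \<^bold>+ \<zero> A B = f"
    and cmp_add: "\<lbrakk>f \<in> hom X A B; g \<in> hom X B C; h \<in> hom X B C\<rbrakk>
      \<Longrightarrow> f \<cdot> (g \<^bold>+ h) = f \<cdot> g \<^bold>+ f \<cdot> h"
    and cmp_zer: "\<lbrakk>f \<in> hom X A B; C \<in> Ob X\<rbrakk> \<Longrightarrow> f \<cdot> \<zero> B C = \<zero> A C"

definition additive_arrow :: "('o, 'a, 'm) ladd_cat_scheme \<Rightarrow> 'a \<Rightarrow> bool" where
  "additive_arrow X f \<longleftrightarrow> f \<in> Ar X \<and>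
     (\<forall>Z\<in>Ob X. cmp X (zer X Z (src X f)) f = zer X Z (tgt X f) \<and>
       (\<forall>g\<in>hom X Z (src X f). \<forall>h\<in>hom X Z (src X f).
          cmp X (add X g h) f = add X (cmp X g f) (cmp X h f)))"

section \<open>Cartesian left additive categories\<close>

record ('o, 'a) cart_ladd_cat = "('o, 'a) ladd_cat" +
  trm :: "'o"  ("\<top>\<index>")
  prd :: "'o \<Rightarrow> 'o \<Rightarrow> 'o"  (infixr "\<times>\<^sub>o\<index>" 75)
  prj0 :: "'o \<Rightarrow> 'o \<Rightarrow> 'a"  ("\<pi>\<^sub>0\<index>")
  prj1 :: "'o \<Rightarrow> 'o \<Rightarrow> 'a"  ("\<pi>\<^sub>1\<index>")
  pairing :: "'a \<Rightarrow> 'a \<Rightarrow> 'a"  ("\<langle>_,/ _\<rangle>\<index>")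

locale cart_left_additive_category = left_additive_category X
  for X :: "('o, 'a, 'm) cart_ladd_cat_scheme" (structure) +
  assumes trm_Ob: "\<top> \<in> Ob X"
    and trm_unique: "A \<in> Ob X \<Longrightarrow> \<exists>!f. f \<in> hom X A \<top>"
    and prd_Ob: "\<lbrakk>A \<in> Ob X; B \<in> Ob X\<rbrakk> \<Longrightarrow> A \<times>\<^sub>o B \<in> Ob X"
    and prj0_hom: "\<lbrakk>A \<in> Ob X; B \<in> Ob X\<rbrakk> \<Longrightarrow> \<pi>\<^sub>0 A B \<in> hom X (A \<times>\<^sub>o B) A"
    and prj1_hom: "\<lbrakk>A \<in> Ob X; B \<in> Ob X\<rbrakk> \<Longrightarrow> \<pi>\<^sub>1 A B \<in> hom X (A \<times>\<^sub>o B) B"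
    and pairing_hom: "\<lbrakk>f \<in> hom X C A; g \<in> hom X C B\<rbrakk> \<Longrightarrow> \<langle>f, g\<rangle> \<in> hom X C (A \<times>\<^sub>o B)"
    and pairing_prj0: "\<lbrakk>f \<in> hom X C A; g \<in> hom X C B\<rbrakk> \<Longrightarrow> \<langle>f, g\<rangle> \<cdot> \<pi>\<^sub>0 A B = f"
    and pairing_prj1: "\<lbrakk>f \<in> hom X C A; g \<in> hom X C B\<rbrakk> \<Longrightarrow> \<langle>f, g\<rangle> \<cdot> \<pi>\<^sub>1 A B = g"
    and pairing_unique: "\<lbrakk>A \<in> Ob X; B \<in> Ob X; h \<in> hom X C (A \<times>\<^sub>o B)\<rbrakk>
      \<Longrightarrow> \<langle>h \<cdot> \<pi>\<^sub>0 A B, h \<cdot> \<pi>\<^sub>1 A B\<rangle> = h"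
    and prj0_additive: "\<lbrakk>A \<in> Ob X; B \<in> Ob X\<rbrakk> \<Longrightarrow> additive_arrow X (\<pi>\<^sub>0 A B)"
    and prj1_additive: "\<lbrakk>A \<in> Ob X; B \<in> Ob X\<rbrakk> \<Longrightarrow> additive_arrow X (\<pi>\<^sub>1 A B)"

context
  fixes X :: "('o, 'a, 'm) cart_ladd_cat_scheme" (structure)
begin

definition prd_map :: "'a \<Rightarrow> 'a \<Rightarrow> 'a" where
  "prd_map f g = \<langle>\<pi>\<^sub>0 (src X f) (src X g) \<cdot> f, \<pi>\<^sub>1 (src X f) (src X g) \<cdot> g\<rangle>"

definition codiag :: "'o \<Rightarrow> 'a" where
  "codiag A = \<pi>\<^sub>0 A A \<^bold>+ \<pi>\<^sub>1 A A"

definition swap :: "'o \<Rightarrow> 'o \<Rightarrow> 'a" where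
  "swap A B = \<langle>\<pi>\<^sub>1 A B, \<pi>\<^sub>0 A B\<rangle>"

definition vlift :: "'o \<Rightarrow> 'o \<Rightarrow> 'o \<Rightarrow> 'o \<Rightarrow> 'a" where
  "vlift A B C D = prd_map \<langle>\<one> A, \<zero> A B\<rangle> \<langle>\<zero> D C, \<one> D\<rangle>"

definition interchange :: "'o \<Rightarrow> 'o \<Rightarrow> 'o \<Rightarrow> 'o \<Rightarrow> 'a" where
  "interchange A B C D =
     \<langle>prd_map (\<pi>\<^sub>0 A B) (\<pi>\<^sub>0 C D), prd_map (\<pi>\<^sub>1 A B) (\<pi>\<^sub>1 C D)\<rangle>"

end

notation prd_map (infixr "\<times>\<^sub>m\<index>" 75)
notation codiag ("\<oplus>\<index>")

section \<open>Cartesian closed left additive categories\<close>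

(* ev C A is evaluation C \<times>\<^sub>o (C \<Rrightarrow> A) \<rightarrow> A, and lam C A f is the curry A \<rightarrow> (C \<Rrightarrow> B) of f : C \<times>\<^sub>o A \<rightarrow> B. *)
record ('o, 'a) cc_ladd_cat = "('o, 'a) cart_ladd_cat" +
  ihom :: "'o \<Rightarrow> 'o \<Rightarrow> 'o"  (infixr "\<Rrightarrow>\<index>" 74)
  ev :: "'o \<Rightarrow> 'o \<Rightarrow> 'a"  ("\<epsilon>\<index>")
  lam :: "'o \<Rightarrow> 'o \<Rightarrow> 'a \<Rightarrow> 'a"  ("\<Lambda>\<index>")

locale cc_left_additive_category = cart_left_additive_category X
  for X :: "('o, 'a, 'm) cc_ladd_cat_scheme" (structure) +
  assumes ihom_Ob: "\<lbrakk>C \<in> Ob X; A \<in> Ob X\<rbrakk> \<Longrightarrow> C \<Rrightarrow> A \<in> Ob X"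
    and ev_hom: "\<lbrakk>C \<in> Ob X; A \<in> Ob X\<rbrakk> \<Longrightarrow> \<epsilon> C A \<in> hom X (C \<times>\<^sub>o (C \<Rrightarrow> A)) A"
    and lam_hom: "\<lbrakk>C \<in> Ob X; A \<in> Ob X; f \<in> hom X (C \<times>\<^sub>o A) B\<rbrakk>
      \<Longrightarrow> \<Lambda> C A f \<in> hom X A (C \<Rrightarrow> B)"
    and lam_ev: "\<lbrakk>C \<in> Ob X; A \<in> Ob X; f \<in> hom X (C \<times>\<^sub>o A) B\<rbrakk>
      \<Longrightarrow> (\<one> C \<times>\<^sub>m \<Lambda> C A f) \<cdot> \<epsilon> C B = f"
    and lam_unique: "\<lbrakk>C \<in> Ob X; A \<in> Ob X; f \<in> hom X (C \<times>\<^sub>o A) B; g \<in> hom X A (C \<Rrightarrow> B);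
        (\<one> C \<times>\<^sub>m g) \<cdot> \<epsilon> C B = f\<rbrakk> \<Longrightarrow> g = \<Lambda> C A f"
    and lam_add: "\<lbrakk>C \<in> Ob X; A \<in> Ob X; f \<in> hom X (C \<times>\<^sub>o A) B; g \<in> hom X (C \<times>\<^sub>o A) B\<rbrakk>
      \<Longrightarrow> \<Lambda> C A (f \<^bold>+ g) = \<Lambda> C A f \<^bold>+ \<Lambda> C A g"
    and lam_zer: "\<lbrakk>C \<in> Ob X; A \<in> Ob X; B \<in> Ob X\<rbrakk>
      \<Longrightarrow> \<Lambda> C A (\<zero> (C \<times>\<^sub>o A) B) = \<zero> A (C \<Rrightarrow> B)"

context
  fixes X :: "('o, 'a, 'm) cc_ladd_cat_scheme" (structure)
begin

definition unlam :: "'o \<Rightarrow> 'o \<Rightarrow> 'a \<Rightarrow> 'a" where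
  "unlam C B g = (\<one> C \<times>\<^sub>m g) \<cdot> \<epsilon> C B"

(* For f : C \<rightarrow> D and g : A \<rightarrow> B this is the map [f,g] : (D \<Rrightarrow> A) \<rightarrow> (C \<Rrightarrow> B). *)
definition ihom_map :: "'a \<Rightarrow> 'a \<Rightarrow> 'a" where
  "ihom_map f g = (let C = src X f; D = tgt X f; A = src X g in
     \<Lambda> C (D \<Rrightarrow> A) ((f \<times>\<^sub>m \<one> (D \<Rrightarrow> A)) \<cdot> \<epsilon> D A \<cdot> g))"

definition eta :: "'o \<Rightarrow> 'o \<Rightarrow> 'a" where
  "eta C A = \<Lambda> C A (\<pi>\<^sub>1 C A)"

definition mu :: "'o \<Rightarrow> 'o \<Rightarrow> 'a" where
  "mu C A = \<Lambda> C (C \<Rrightarrow> C \<Rrightarrow> A)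
     (\<langle>\<pi>\<^sub>0 C (C \<Rrightarrow> C \<Rrightarrow> A), \<epsilon> C (C \<Rrightarrow> A)\<rangle> \<cdot> \<epsilon> C A)"

end

notation unlam ("\<Lambda>inv\<index>")

section \<open>Differential combinators\<close>

locale differential_combinator = cart_left_additive_category X
  for X :: "('o, 'a, 'm) cart_ladd_cat_scheme" (structure) +
  fixes D :: "'a \<Rightarrow> 'a"
  assumes D_hom: "f \<in> hom X A B \<Longrightarrow> D f \<in> hom X (A \<times>\<^sub>o A) B"
    and CD1_add: "\<lbrakk>f \<in> hom X A B; g \<in> hom X A B\<rbrakk> \<Longrightarrow> D (f \<^bold>+ g) = D f \<^bold>+ D g"
    and CD1_zer: "\<lbrakk>A \<in> Ob X; B \<in> Ob X\<rbrakk> \<Longrightarrow> D (\<zero> A B) = \<zero> (A \<times>\<^sub>o A) B"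
    and CD2_add: "f \<in> hom X A B \<Longrightarrow>
      (\<one> A \<times>\<^sub>m \<oplus> A) \<cdot> D f = (\<one> A \<times>\<^sub>m \<pi>\<^sub>0 A A) \<cdot> D f \<^bold>+ (\<one> A \<times>\<^sub>m \<pi>\<^sub>1 A A) \<cdot> D f"
    and CD2_zer: "f \<in> hom X A B \<Longrightarrow> \<langle>\<one> A, \<zero> A A\<rangle> \<cdot> D f = \<zero> A B"
    and CD3_idn: "A \<in> Ob X \<Longrightarrow> D (\<one> A) = \<pi>\<^sub>1 A A"
    and CD3_prj0: "\<lbrakk>A \<in> Ob X; B \<in> Ob X\<rbrakk>
      \<Longrightarrow> D (\<pi>\<^sub>0 A B) = \<pi>\<^sub>1 (A \<times>\<^sub>o B) (A \<times>\<^sub>o B) \<cdot> \<pi>\<^sub>0 A B"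
    and CD3_prj1: "\<lbrakk>A \<in> Ob X; B \<in> Ob X\<rbrakk>
      \<Longrightarrow> D (\<pi>\<^sub>1 A B) = \<pi>\<^sub>1 (A \<times>\<^sub>o B) (A \<times>\<^sub>o B) \<cdot> \<pi>\<^sub>1 A B"
    and CD4: "\<lbrakk>f \<in> hom X C A; g \<in> hom X C B\<rbrakk> \<Longrightarrow> D \<langle>f, g\<rangle> = \<langle>D f, D g\<rangle>"
    and CD5: "\<lbrakk>f \<in> hom X A B; g \<in> hom X B C\<rbrakk>
      \<Longrightarrow> D (f \<cdot> g) = \<langle>\<pi>\<^sub>0 A A \<cdot> f, D f\<rangle> \<cdot> D g"
    and CD6: "f \<in> hom X A B \<Longrightarrow> vlift X A A A A \<cdot> D (D f) = D f"
    and CD7: "f \<in> hom X A B \<Longrightarrow> interchange X A A A A \<cdot> D (D f) = D (D f)"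

definition partial_D ::
    "('o, 'a, 'm) cart_ladd_cat_scheme \<Rightarrow> ('a \<Rightarrow> 'a) \<Rightarrow> 'o \<Rightarrow> 'o \<Rightarrow> 'a \<Rightarrow> 'a" where
  "partial_D X D C A f =
     cmp X (pairing X (prd_map X (idn X C) (prj0 X A A)) (prd_map X (zer X C C) (prj1 X A A))) (D f)"

definition CD_lambda :: "('o, 'a, 'm) cc_ladd_cat_scheme \<Rightarrow> ('a \<Rightarrow> 'a) \<Rightarrow> bool" where
  "CD_lambda X D \<longleftrightarrow> (\<forall>C\<in>Ob X. \<forall>A\<in>Ob X. \<forall>B\<in>Ob X. \<forall>f\<in>hom X (prd X C A) B.
     D (lam X C A f) = lam X C (prd X A A) (partial_D X D C A f))"

definition CD_ev :: "('o, 'a, 'm) cc_ladd_cat_scheme \<Rightarrow> ('a \<Rightarrow> 'a) \<Rightarrow> bool" where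
  "CD_ev X D \<longleftrightarrow> (\<forall>C\<in>Ob X. \<forall>A\<in>Ob X.
     partial_D X D C (ihom X C A) (ev X C A) =
       cmp X (prd_map X (idn X C) (prj1 X (ihom X C A) (ihom X C A))) (ev X C A))"

locale cc_differential_category = cc_left_additive_category X + differential_combinator X D
  for X :: "('o, 'a, 'm) cc_ladd_cat_scheme" (structure) and D :: "'a \<Rightarrow> 'a" +
  assumes CD_lambda: "CD_lambda X D"

section \<open>Linearizing combinators\<close>

locale linearizing_combinator = cart_left_additive_category X
  for X :: "('o, 'a, 'm) cart_ladd_cat_scheme" (structure) +
  fixes L :: "'a \<Rightarrow> 'a"
  assumes L_hom: "f \<in> hom X A B \<Longrightarrow> L f \<in> hom X A B"
    and L1_add: "\<lbrakk>f \<in> hom X A B; g \<in> hom X A B\<rbrakk> \<Longrightarrow> L (f \<^bold>+ g) = L f \<^bold>+ L g"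
    and L1_zer: "\<lbrakk>A \<in> Ob X; B \<in> Ob X\<rbrakk> \<Longrightarrow> L (\<zero> A B) = \<zero> A B"
    and L2: "f \<in> hom X A B \<Longrightarrow> additive_arrow X (L f)"
    and L3_idn: "A \<in> Ob X \<Longrightarrow> L (\<one> A) = \<one> A"
    and L3_prj0: "\<lbrakk>A \<in> Ob X; B \<in> Ob X\<rbrakk> \<Longrightarrow> L (\<pi>\<^sub>0 A B) = \<pi>\<^sub>0 A B"
    and L3_prj1: "\<lbrakk>A \<in> Ob X; B \<in> Ob X\<rbrakk> \<Longrightarrow> L (\<pi>\<^sub>1 A B) = \<pi>\<^sub>1 A B"
    and L4: "\<lbrakk>f \<in> hom X C A; g \<in> hom X C B\<rbrakk> \<Longrightarrow> L \<langle>f, g\<rangle> = \<langle>L f, L g\<rangle>"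
    and L5: "\<lbrakk>f \<in> hom X A B; g \<in> hom X B C\<rbrakk>
      \<Longrightarrow> L (f \<cdot> g) = L f \<cdot> L ((\<one> B \<^bold>+ \<zero> B A \<cdot> f) \<cdot> g)"
    and L6: "f \<in> hom X A B \<Longrightarrow> L (L f) = L f"

(* For f : A \<times>\<^sub>o B \<rightarrow> C: linearization of f in its first, respectively second, argument. *)
definition L_fst :: "('o, 'a, 'm) cc_ladd_cat_scheme \<Rightarrow> ('a \<Rightarrow> 'a) \<Rightarrow> 'o \<Rightarrow> 'o \<Rightarrow> 'a \<Rightarrow> 'a" where
  "L_fst X L A B f =
     cmp X (swap X A B) (unlam X B (tgt X f) (L (lam X B A (cmp X (swap X B A) f))))"

definition L_snd :: "('o, 'a, 'm) cc_ladd_cat_scheme \<Rightarrow> ('a \<Rightarrow> 'a) \<Rightarrow> 'o \<Rightarrow> 'o \<Rightarrow> 'a \<Rightarrow> 'a" where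
  "L_snd X L A B f = unlam X A (tgt X f) (L (lam X A B f))"

locale exponentiable_linearizing_combinator =
  cc_left_additive_category X + linearizing_combinator X L
  for X :: "('o, 'a, 'm) cc_ladd_cat_scheme" (structure) and L :: "'a \<Rightarrow> 'a" +
  assumes EL1_eta: "\<lbrakk>C \<in> Ob X; A \<in> Ob X\<rbrakk> \<Longrightarrow> L (eta X C A) = eta X C A"
    and EL1_mu: "\<lbrakk>C \<in> Ob X; A \<in> Ob X\<rbrakk> \<Longrightarrow> L (mu X C A) = mu X C A"
    and EL2: "\<lbrakk>f \<in> hom X C D; g \<in> hom X A B\<rbrakk> \<Longrightarrow> L (ihom_map X f g) = ihom_map X f (L g)"
    and EL3: "\<lbrakk>A \<in> Ob X; B \<in> Ob X; f \<in> hom X (A \<times>\<^sub>o B) C\<rbrakk>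
      \<Longrightarrow> L_fst X L A B (L_snd X L A B f) = L_snd X L A B (L_fst X L A B f)"

section \<open>Systems of linearizing combinators\<close>

(* In the system L, the operator L C A acts on arrows with source C \<times>\<^sub>o A. *)

context
  fixes X :: "('o, 'a, 'm) cart_ladd_cat_scheme" (structure)
begin

definition alpha :: "'o \<Rightarrow> 'o \<Rightarrow> 'o \<Rightarrow> 'a" where
  "alpha C A B = \<langle>\<one> C \<times>\<^sub>m \<pi>\<^sub>0 A B, \<pi>\<^sub>1 C (A \<times>\<^sub>o B) \<cdot> \<pi>\<^sub>1 A B\<rangle>"

definition beta :: "'o \<Rightarrow> 'o \<Rightarrow> 'o \<Rightarrow> 'a" where
  "beta C A B = \<langle>\<one> C \<times>\<^sub>m \<pi>\<^sub>1 A B, \<pi>\<^sub>1 C (A \<times>\<^sub>o B) \<cdot> \<pi>\<^sub>0 A B\<rangle>"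

definition LS_fst :: "('o \<Rightarrow> 'o \<Rightarrow> 'a \<Rightarrow> 'a) \<Rightarrow> 'o \<Rightarrow> 'o \<Rightarrow> 'o \<Rightarrow> 'a \<Rightarrow> 'a" where
  "LS_fst L C A B f = beta C A B \<cdot> L (C \<times>\<^sub>o B) A (inverse_arrow X (beta C A B) \<cdot> f)"

definition LS_snd :: "('o \<Rightarrow> 'o \<Rightarrow> 'a \<Rightarrow> 'a) \<Rightarrow> 'o \<Rightarrow> 'o \<Rightarrow> 'o \<Rightarrow> 'a \<Rightarrow> 'a" where
  "LS_snd L C A B f = alpha C A B \<cdot> L (C \<times>\<^sub>o A) B (inverse_arrow X (alpha C A B) \<cdot> f)"

definition induced_L :: "('o \<Rightarrow> 'o \<Rightarrow> 'a \<Rightarrow> 'a) \<Rightarrow> 'a \<Rightarrow> 'a" where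
  "induced_L L f = (let A = src X f in \<langle>\<zero> A \<top>, \<one> A\<rangle> \<cdot> L \<top> A (\<pi>\<^sub>1 \<top> A \<cdot> f))"

definition induced_D :: "('o \<Rightarrow> 'o \<Rightarrow> 'a \<Rightarrow> 'a) \<Rightarrow> 'a \<Rightarrow> 'a" where
  "induced_D L f = (let A = src X f in L A A (\<oplus> A \<cdot> f))"

end

locale linearizing_system = cart_left_additive_category X
  for X :: "('o, 'a, 'm) cart_ladd_cat_scheme" (structure) +
  fixes L :: "'o \<Rightarrow> 'o \<Rightarrow> 'a \<Rightarrow> 'a"
  assumes LS_hom: "\<lbrakk>C \<in> Ob X; A \<in> Ob X; f \<in> hom X (C \<times>\<^sub>o A) B\<rbrakk>
      \<Longrightarrow> L C A f \<in> hom X (C \<times>\<^sub>o A) B"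
    and LS1_add: "\<lbrakk>C \<in> Ob X; A \<in> Ob X; f \<in> hom X (C \<times>\<^sub>o A) B; g \<in> hom X (C \<times>\<^sub>o A) B\<rbrakk>
      \<Longrightarrow> L C A (f \<^bold>+ g) = L C A f \<^bold>+ L C A g"
    and LS1_zer: "\<lbrakk>C \<in> Ob X; A \<in> Ob X; B \<in> Ob X\<rbrakk>
      \<Longrightarrow> L C A (\<zero> (C \<times>\<^sub>o A) B) = \<zero> (C \<times>\<^sub>o A) B"
    and LS2_add: "\<lbrakk>C \<in> Ob X; A \<in> Ob X; f \<in> hom X (C \<times>\<^sub>o A) B\<rbrakk>
      \<Longrightarrow> (\<one> C \<times>\<^sub>m \<oplus> A) \<cdot> L C A f =
          (\<one> C \<times>\<^sub>m \<pi>\<^sub>0 A A) \<cdot> L C A f \<^bold>+ (\<one> C \<times>\<^sub>m \<pi>\<^sub>1 A A) \<cdot> L C A f"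
    and LS2_zer: "\<lbrakk>C \<in> Ob X; A \<in> Ob X; f \<in> hom X (C \<times>\<^sub>o A) B\<rbrakk>
      \<Longrightarrow> \<langle>\<pi>\<^sub>0 C A, \<zero> (C \<times>\<^sub>o A) A\<rangle> \<cdot> L C A f = \<zero> (C \<times>\<^sub>o A) B"
    and LS3_idn: "\<lbrakk>C \<in> Ob X; A \<in> Ob X\<rbrakk> \<Longrightarrow> L C A (\<pi>\<^sub>1 C A) = \<pi>\<^sub>1 C A"
    and LS3_prj0: "\<lbrakk>C \<in> Ob X; A \<in> Ob X; B \<in> Ob X\<rbrakk>
      \<Longrightarrow> L C (A \<times>\<^sub>o B) (\<pi>\<^sub>1 C (A \<times>\<^sub>o B) \<cdot> \<pi>\<^sub>0 A B) = \<pi>\<^sub>1 C (A \<times>\<^sub>o B) \<cdot> \<pi>\<^sub>0 A B"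
    and LS3_prj1: "\<lbrakk>C \<in> Ob X; A \<in> Ob X; B \<in> Ob X\<rbrakk>
      \<Longrightarrow> L C (A \<times>\<^sub>o B) (\<pi>\<^sub>1 C (A \<times>\<^sub>o B) \<cdot> \<pi>\<^sub>1 A B) = \<pi>\<^sub>1 C (A \<times>\<^sub>o B) \<cdot> \<pi>\<^sub>1 A B"
    and LS4: "\<lbrakk>C \<in> Ob X; A \<in> Ob X; f \<in> hom X (C \<times>\<^sub>o A) B; g \<in> hom X (C \<times>\<^sub>o A) B'\<rbrakk>
      \<Longrightarrow> L C A \<langle>f, g\<rangle> = \<langle>L C A f, L C A g\<rangle>"
    and LS5: "\<lbrakk>C \<in> Ob X; A \<in> Ob X; B \<in> Ob X; f \<in> hom X (C \<times>\<^sub>o A) B; g \<in> hom X (C \<times>\<^sub>o B) B'\<rbrakk>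
      \<Longrightarrow> L C A (\<langle>\<pi>\<^sub>0 C A, f\<rangle> \<cdot> g) =
          \<langle>\<pi>\<^sub>0 C A, L C A f\<rangle> \<cdot>
            L C B (\<langle>\<pi>\<^sub>0 C B, \<pi>\<^sub>1 C B \<^bold>+ \<langle>\<pi>\<^sub>0 C B, \<zero> (C \<times>\<^sub>o B) A\<rangle> \<cdot> f\<rangle> \<cdot> g)"
    and LS6: "\<lbrakk>C \<in> Ob X; A \<in> Ob X; f \<in> hom X (C \<times>\<^sub>o A) B\<rbrakk>
      \<Longrightarrow> L C A (L C A f) = L C A f"
    and LS7: "\<lbrakk>C \<in> Ob X; A \<in> Ob X; B \<in> Ob X; f \<in> hom X (C \<times>\<^sub>o (A \<times>\<^sub>o B)) D\<rbrakk>
      \<Longrightarrow> LS_snd X L C A B (LS_fst X L C A B f) = LS_fst X L C A B (LS_snd X L C A B f)"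
    and LS8: "\<lbrakk>C \<in> Ob X; A \<in> Ob X; h \<in> hom X C' C; f \<in> hom X (C \<times>\<^sub>o A) B\<rbrakk>
      \<Longrightarrow> (h \<times>\<^sub>m \<one> A) \<cdot> L C A f = L C' A ((h \<times>\<^sub>m \<one> A) \<cdot> f)"

locale closed_linearizing_system = cc_left_additive_category X + linearizing_system X L
  for X :: "('o, 'a, 'm) cc_ladd_cat_scheme" (structure) and L :: "'o \<Rightarrow> 'o \<Rightarrow> 'a \<Rightarrow> 'a" +
  assumes L_lambda: "\<lbrakk>C \<in> Ob X; A \<in> Ob X; f \<in> hom X (C \<times>\<^sub>o A) B\<rbrakk>
      \<Longrightarrow> induced_L X L (\<Lambda> C A f) = \<Lambda> C A (L C A f)"

end

theory Submission
  imports Defs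
begin

text \<open>
  Read an arrow f : C \<times> A \<rightarrow> B as a family of maps f(c,a) with parameter c, and L_C[f](c,a) as
  the part of f that is linear in a at a = 0.  The system axioms then yield the rules of a partial
  derivative at 0: it kills terms constant in a (\<open>L_const\<close>), it may be pulled through a linear
  substitution for a (\<open>L_precomp_linear\<close>), it commutes with a linear outer function
  (\<open>L_postcomp_linear\<close>), and it ignores substitutions in the parameter (\<open>L_at_reindex\<close>).

  With D[f](a,v) the linear part of f(a + v) in v, most differential axioms are one application of
  these rules; the chain rule is \<open>LS5\<close> followed by a change of parameter from a to f(a).  The
  exception is symmetry of the second derivative.  Linearity in the second argument pair splits
  D[D[f]]((a,v),(b,w)) as E(a,v,b) + D[f](a,w) (\<open>DL_DL_split\<close>), where E(a,v,b) linearizes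
  f(a + b + v) first in v and then in b.  Since a + b + v is symmetric in b and v, the
  commutation \<open>LS7\<close> of partial linearizations makes E symmetric (\<open>DL_DL_symmetric\<close>).

  The key consequence of closedness is that evaluation is linear in the function argument,
  L_C[\<epsilon>] = \<epsilon> (\<open>L_ev\<close>), because \<epsilon> is the uncurried identity.  By the outer-function rule,
  linearizing a curried map at a point c is the same as linearizing the uncurried map with c as an
  additional parameter (\<open>L_ev_postcomp\<close>); this gives \<open>CD_lambda\<close> (\<open>DL_lam\<close>), and \<open>CD_ev\<close> is the case
  of the identity of an exponential.  The same linearity of \<epsilon>, together with the identification
  of parameters C = \<top> with no parameter, gives exponentiability (\<open>exponentiable_L0\<close>).
\<close>

section \<open>Calculation in Cartesian left additive categories\<close>

lemma homD: "f \<in> hom X A B \<Longrightarrow> f \<in> Ar X \<and> src X f = A \<and> tgt X f = B"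
  by (simp add: hom_def)

context category
begin

text \<open>
  The laws are restated with typing conditions on \<open>src\<close> and \<open>tgt\<close>: those can be computed from an
  expression, whereas membership in \<open>hom\<close> would make the simplifier guess the middle object of
  each composite.  Composites are normalized by bracketing to the left.
\<close>

lemma idn_typing:
  assumes "A \<in> Ob X"
  shows "\<one> A \<in> Ar X" "src X (\<one> A) = A" "tgt X (\<one> A) = A"
  using idn_hom[OF assms] by (simp_all add: hom_def)

lemma cmp_typing:
  assumes "f \<in> Ar X" "g \<in> Ar X" "tgt X f = src X g"
  shows "f \<cdot> g \<in> Ar X" "src X (f \<cdot> g) = src X f" "tgt X (f \<cdot> g) = tgt X g"
  using cmp_hom[of f "src X f" "tgt X f" g "tgt X g"] assms by (simp_all add: hom_def)

lemma idn_cmp': "\<lbrakk>f \<in> Ar X; src X f = A\<rbrakk> \<Longrightarrow> \<one> A \<cdot> f = f"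
  using idn_cmp[of f A "tgt X f"] by (simp add: hom_def)

lemma cmp_idn': "\<lbrakk>f \<in> Ar X; tgt X f = B\<rbrakk> \<Longrightarrow> f \<cdot> \<one> B = f"
  using cmp_idn[of f "src X f" B] by (simp add: hom_def)

lemma cmp_assoc': "\<lbrakk>f \<in> Ar X; g \<in> Ar X; h \<in> Ar X; tgt X f = src X g; tgt X g = src X h\<rbrakk>
    \<Longrightarrow> f \<cdot> (g \<cdot> h) = f \<cdot> g \<cdot> h"
  using cmp_assoc[of f "src X f" "tgt X f" g "tgt X g" h "tgt X h"] by (simp add: hom_def)

lemma inverse_arrow_eq:
  assumes "f \<in> hom X A B" "g \<in> hom X B A" "f \<cdot> g = \<one> A" "g \<cdot> f = \<one> B"
  shows "inverse_arrow X f = g"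
  unfolding inverse_arrow_def
proof (rule the_equality)
  show "g \<in> hom X (tgt X f) (src X f) \<and> f \<cdot> g = \<one> (src X f) \<and> g \<cdot> f = \<one> (tgt X f)"
    using assms by (simp add: hom_def)
next
  fix k
  assume "k \<in> hom X (tgt X f) (src X f) \<and> f \<cdot> k = \<one> (src X f) \<and> k \<cdot> f = \<one> (tgt X f)"
  then have k: "k \<in> hom X B A" "k \<cdot> f = \<one> B"
    using assms(1) by (simp_all add: hom_def)
  have "k = k \<cdot> (f \<cdot> g)"
    using cmp_idn[OF k(1)] assms(3) by simp
  also have "\<dots> = g"
    using cmp_assoc[OF k(1) assms(1,2)] k(2) idn_cmp[OF assms(2)] by simp
  finally show "k = g" .
qed

end

context left_additive_category
begin

lemma add_typing:
  assumes "f \<in> Ar X" "g \<in> Ar X" "src X f = src X g" "tgt X f = tgt X g"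
  shows "f \<^bold>+ g \<in> Ar X" "src X (f \<^bold>+ g) = src X g" "tgt X (f \<^bold>+ g) = tgt X g"
  using add_hom[of f "src X g" "tgt X g" g] assms by (simp_all add: hom_def)

lemma zer_typing:
  assumes "A \<in> Ob X" "B \<in> Ob X"
  shows "\<zero> A B \<in> Ar X" "src X (\<zero> A B) = A" "tgt X (\<zero> A B) = B"
  using zer_hom[OF assms] by (simp_all add: hom_def)

lemma add_comm': "\<lbrakk>f \<in> Ar X; g \<in> Ar X; src X f = src X g; tgt X f = tgt X g\<rbrakk>
    \<Longrightarrow> f \<^bold>+ g = g \<^bold>+ f"
  using add_comm[of f "src X g" "tgt X g" g] by (simp add: hom_def)

lemma add_assoc': "\<lbrakk>f \<in> Ar X; g \<in> Ar X; h \<in> Ar X; src X f = src X g; tgt X f = tgt X g;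
     src X g = src X h; tgt X g = tgt X h\<rbrakk> \<Longrightarrow> f \<^bold>+ g \<^bold>+ h = f \<^bold>+ (g \<^bold>+ h)"
  using add_assoc[of f "src X h" "tgt X h" g h] by (simp add: hom_def)

lemma add_left_comm': "\<lbrakk>f \<in> Ar X; g \<in> Ar X; h \<in> Ar X; src X f = src X g; tgt X f = tgt X g;
     src X g = src X h; tgt X g = tgt X h\<rbrakk> \<Longrightarrow> f \<^bold>+ (g \<^bold>+ h) = g \<^bold>+ (f \<^bold>+ h)"
  using add_assoc'[of f g h] add_assoc'[of g f h] add_comm'[of f g] by simp

lemma add_zer': "\<lbrakk>f \<in> Ar X; src X f = A; tgt X f = B\<rbrakk> \<Longrightarrow> f \<^bold>+ \<zero> A B = f"
  using add_zer[of f A B] by (simp add: hom_def)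

lemma zer_add': "\<lbrakk>f \<in> Ar X; src X f = A; tgt X f = B\<rbrakk> \<Longrightarrow> \<zero> A B \<^bold>+ f = f"
  using add_zer[of f A B] add_comm[of f A B "\<zero> A B"] zer_hom src_Ob tgt_Ob
  by (auto simp: hom_def)

lemma cmp_add': "\<lbrakk>f \<in> Ar X; g \<in> Ar X; h \<in> Ar X; tgt X f = src X g; src X g = src X h;
     tgt X g = tgt X h\<rbrakk> \<Longrightarrow> f \<cdot> (g \<^bold>+ h) = f \<cdot> g \<^bold>+ f \<cdot> h"
  using cmp_add[of f "src X f" "tgt X f" g "tgt X g" h] by (simp add: hom_def)

lemma cmp_zer': "\<lbrakk>f \<in> Ar X; tgt X f = B; C \<in> Ob X\<rbrakk> \<Longrightarrow> f \<cdot> \<zero> B C = \<zero> (src X f) C"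
  using cmp_zer[of f "src X f" B C] by (simp add: hom_def)

end

context cart_left_additive_category
begin

lemma prj_typing:
  assumes "A \<in> Ob X" "B \<in> Ob X"
  shows "\<pi>\<^sub>0 A B \<in> Ar X" "src X (\<pi>\<^sub>0 A B) = A \<times>\<^sub>o B" "tgt X (\<pi>\<^sub>0 A B) = A"
    "\<pi>\<^sub>1 A B \<in> Ar X" "src X (\<pi>\<^sub>1 A B) = A \<times>\<^sub>o B" "tgt X (\<pi>\<^sub>1 A B) = B"
  using prj0_hom[OF assms] prj1_hom[OF assms] by (simp_all add: hom_def)

lemma pairing_typing:
  assumes "f \<in> Ar X" "g \<in> Ar X" "src X f = src X g"
  shows "\<langle>f, g\<rangle> \<in> Ar X" "src X \<langle>f, g\<rangle> = src X g" "tgt X \<langle>f, g\<rangle> = tgt X f \<times>\<^sub>o tgt X g"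
  using pairing_hom[of f "src X g" "tgt X f" g "tgt X g"] assms by (simp_all add: hom_def)

lemma pairing_prj:
  assumes "f \<in> Ar X" "g \<in> Ar X" "src X f = src X g" "tgt X f = A" "tgt X g = B"
  shows "\<langle>f, g\<rangle> \<cdot> \<pi>\<^sub>0 A B = f" "\<langle>f, g\<rangle> \<cdot> \<pi>\<^sub>1 A B = g"
  using pairing_prj0[of f "src X f" A g B] pairing_prj1[of f "src X f" A g B] assms
  by (simp_all add: hom_def)

lemma pairing_eta: "\<lbrakk>A \<in> Ob X; B \<in> Ob X; h \<in> Ar X; tgt X h = A \<times>\<^sub>o B\<rbrakk>
    \<Longrightarrow> \<langle>h \<cdot> \<pi>\<^sub>0 A B, h \<cdot> \<pi>\<^sub>1 A B\<rangle> = h"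
  using pairing_unique[of A B h "src X h"] by (simp add: hom_def)

lemma pairing_prjs: "\<lbrakk>A \<in> Ob X; B \<in> Ob X\<rbrakk> \<Longrightarrow> \<langle>\<pi>\<^sub>0 A B, \<pi>\<^sub>1 A B\<rangle> = \<one> (A \<times>\<^sub>o B)"
  using pairing_eta[of A B "\<one> (A \<times>\<^sub>o B)"]
  by (simp add: idn_typing idn_cmp' prd_Ob prj_typing)

lemma prj_add:
  assumes "A \<in> Ob X" "B \<in> Ob X" "g \<in> Ar X" "h \<in> Ar X" "src X g = src X h"
    "tgt X g = A \<times>\<^sub>o B" "tgt X h = A \<times>\<^sub>o B"
  shows "(g \<^bold>+ h) \<cdot> \<pi>\<^sub>0 A B = g \<cdot> \<pi>\<^sub>0 A B \<^bold>+ h \<cdot> \<pi>\<^sub>0 A B"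
    "(g \<^bold>+ h) \<cdot> \<pi>\<^sub>1 A B = g \<cdot> \<pi>\<^sub>1 A B \<^bold>+ h \<cdot> \<pi>\<^sub>1 A B"
  using prj0_additive[OF assms(1,2)] prj1_additive[OF assms(1,2)] assms src_Ob[of h]
  by (auto simp: additive_arrow_def hom_def prj_typing)

lemma zer_prj:
  assumes "Z \<in> Ob X" "A \<in> Ob X" "B \<in> Ob X"
  shows "\<zero> Z (A \<times>\<^sub>o B) \<cdot> \<pi>\<^sub>0 A B = \<zero> Z A" "\<zero> Z (A \<times>\<^sub>o B) \<cdot> \<pi>\<^sub>1 A B = \<zero> Z B"
  using prj0_additive[OF assms(2,3)] prj1_additive[OF assms(2,3)] assms
  by (auto simp: additive_arrow_def prj_typing)

lemma pairing_ext:
  assumes "A \<in> Ob X" "B \<in> Ob X" "h \<in> Ar X" "k \<in> Ar X" "tgt X h = A \<times>\<^sub>o B" "tgt X k = A \<times>\<^sub>o B"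
    "h \<cdot> \<pi>\<^sub>0 A B = k \<cdot> \<pi>\<^sub>0 A B" "h \<cdot> \<pi>\<^sub>1 A B = k \<cdot> \<pi>\<^sub>1 A B"
  shows "h = k"
  by (metis assms pairing_eta)

lemma cmp_pairing:
  assumes "h \<in> Ar X" "f \<in> Ar X" "g \<in> Ar X" "tgt X h = src X f" "src X f = src X g"
  shows "h \<cdot> \<langle>f, g\<rangle> = \<langle>h \<cdot> f, h \<cdot> g\<rangle>"
  by (rule pairing_ext[of "tgt X f" "tgt X g"])
    (use assms in
      \<open>simp_all add: tgt_Ob pairing_typing cmp_typing pairing_prj prj_typing flip: cmp_assoc'\<close>)

lemma add_pairing:
  assumes "f \<in> Ar X" "g \<in> Ar X" "f' \<in> Ar X" "g' \<in> Ar X" "src X f = src X g"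
    "src X f' = src X g'" "src X g = src X g'" "tgt X f = tgt X f'" "tgt X g = tgt X g'"
  shows "\<langle>f, g\<rangle> \<^bold>+ \<langle>f', g'\<rangle> = \<langle>f \<^bold>+ f', g \<^bold>+ g'\<rangle>"
  by (rule pairing_ext[of "tgt X f" "tgt X g"])
    (use assms in \<open>simp_all add: tgt_Ob pairing_typing add_typing prj_add pairing_prj\<close>)

lemma prj0_trm: "A \<in> Ob X \<Longrightarrow> \<pi>\<^sub>0 \<top> A = \<zero> (\<top> \<times>\<^sub>o A) \<top>"
  using trm_unique[of "\<top> \<times>\<^sub>o A"] prj0_hom[of \<top> A] zer_hom[of "\<top> \<times>\<^sub>o A" \<top>]
  by (auto simp: prd_Ob trm_Ob)

lemmas typing = idn_typing cmp_typing add_typing zer_typing prj_typing pairing_typing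
  prd_Ob trm_Ob

text \<open>
  The normal form pushes composition into pairings and sums from the left.  With brackets to the
  left each redex, such as a pairing followed by a projection, is a subterm, so no variants of the
  laws with a trailing factor are needed.
\<close>

lemmas calc = typing idn_cmp' cmp_idn' cmp_assoc' add_zer' zer_add' cmp_add' cmp_zer'
  pairing_prj pairing_eta pairing_prjs prj_add zer_prj cmp_pairing add_pairing
  prd_map_def codiag_def prj0_trm

lemmas add_ac = add_assoc' add_comm' add_left_comm'

lemma inverse_alpha:
  assumes "C \<in> Ob X" "A \<in> Ob X" "B \<in> Ob X"
  shows "inverse_arrow X (alpha X C A B) =
    \<langle>\<pi>\<^sub>0 (C \<times>\<^sub>o A) B \<cdot> \<pi>\<^sub>0 C A, \<langle>\<pi>\<^sub>0 (C \<times>\<^sub>o A) B \<cdot> \<pi>\<^sub>1 C A, \<pi>\<^sub>1 (C \<times>\<^sub>o A) B\<rangle>\<rangle>"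
  by (rule inverse_arrow_eq[of _ "C \<times>\<^sub>o (A \<times>\<^sub>o B)" "(C \<times>\<^sub>o A) \<times>\<^sub>o B"])
    (use assms in \<open>simp_all add: hom_def alpha_def calc\<close>)

lemma inverse_beta:
  assumes "C \<in> Ob X" "A \<in> Ob X" "B \<in> Ob X"
  shows "inverse_arrow X (beta X C A B) =
    \<langle>\<pi>\<^sub>0 (C \<times>\<^sub>o B) A \<cdot> \<pi>\<^sub>0 C B, \<langle>\<pi>\<^sub>1 (C \<times>\<^sub>o B) A, \<pi>\<^sub>0 (C \<times>\<^sub>o B) A \<cdot> \<pi>\<^sub>1 C B\<rangle>\<rangle>"
  by (rule inverse_arrow_eq[of _ "C \<times>\<^sub>o (A \<times>\<^sub>o B)" "(C \<times>\<^sub>o B) \<times>\<^sub>o A"])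
    (use assms in \<open>simp_all add: hom_def beta_def calc\<close>)

end

section \<open>Linear maps in a linearizing system\<close>

context linearizing_system
begin

lemma L_typing:
  assumes "C \<in> Ob X" "A \<in> Ob X" "f \<in> Ar X" "src X f = C \<times>\<^sub>o A"
  shows "L C A f \<in> Ar X" "src X (L C A f) = C \<times>\<^sub>o A" "tgt X (L C A f) = tgt X f"
  using LS_hom[of C A f "tgt X f"] assms by (simp_all add: hom_def)

text \<open>
  \<open>LS2_add\<close> is an equation at the generic point of C \<times> (A \<times> A); substituting \<langle>c, \<langle>x, y\<rangle>\<rangle> turns
  it into additivity at arbitrary generalized elements.
\<close>

lemma L_at_add:
  assumes "f \<in> hom X (C \<times>\<^sub>o A) B" "c \<in> hom X Z C" "x \<in> hom X Z A" "y \<in> hom X Z A"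
  shows "\<langle>c, x \<^bold>+ y\<rangle> \<cdot> L C A f = \<langle>c, x\<rangle> \<cdot> L C A f \<^bold>+ \<langle>c, y\<rangle> \<cdot> L C A f"
proof -
  note [simp] = homD[OF assms(1)] homD[OF assms(2)] homD[OF assms(3)] homD[OF assms(4)]
  have ob [simp]: "C \<in> Ob X" "A \<in> Ob X"
    using tgt_Ob[of c] tgt_Ob[of x] by auto
  have "\<langle>c, \<langle>x, y\<rangle>\<rangle> \<cdot> ((\<one> C \<times>\<^sub>m \<oplus> A) \<cdot> L C A f) =
      \<langle>c, \<langle>x, y\<rangle>\<rangle> \<cdot> ((\<one> C \<times>\<^sub>m \<pi>\<^sub>0 A A) \<cdot> L C A f \<^bold>+ (\<one> C \<times>\<^sub>m \<pi>\<^sub>1 A A) \<cdot> L C A f)"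
    using LS2_add[OF ob assms(1)] by simp
  then show ?thesis by (simp add: calc L_typing)
qed

lemma L_at_zer:
  assumes "A \<in> Ob X" "f \<in> hom X (C \<times>\<^sub>o A) B" "c \<in> hom X Z C"
  shows "\<langle>c, \<zero> Z A\<rangle> \<cdot> L C A f = \<zero> Z B"
proof -
  note [simp] = assms(1) homD[OF assms(2)] homD[OF assms(3)]
  have ob [simp]: "C \<in> Ob X" "Z \<in> Ob X" "B \<in> Ob X"
    using tgt_Ob[of c] src_Ob[of c] tgt_Ob[of f] by auto
  have "\<langle>c, \<zero> Z A\<rangle> \<cdot> (\<langle>\<pi>\<^sub>0 C A, \<zero> (C \<times>\<^sub>o A) A\<rangle> \<cdot> L C A f) = \<langle>c, \<zero> Z A\<rangle> \<cdot> \<zero> (C \<times>\<^sub>o A) B"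
    using LS2_zer[OF ob(1) assms(1,2)] by simp
  then show ?thesis by (simp add: calc L_typing)
qed

text \<open>
  A map constant in the linearized argument equals itself precomposed with \<langle>\<pi>_0, 0\<rangle>, so the
  chain rule \<open>LS5\<close> evaluates some linearization at L[0] = 0, where it vanishes.
\<close>

lemma L_const:
  assumes "C \<in> Ob X" "A \<in> Ob X" "f \<in> hom X C B"
  shows "L C A (\<pi>\<^sub>0 C A \<cdot> f) = \<zero> (C \<times>\<^sub>o A) B"
proof -
  note [simp] = assms(1,2) homD[OF assms(3)]
  let ?g = "\<pi>\<^sub>0 C A \<cdot> f"
  have "L C A (\<langle>\<pi>\<^sub>0 C A, \<zero> (C \<times>\<^sub>o A) A\<rangle> \<cdot> ?g) = \<langle>\<pi>\<^sub>0 C A, L C A (\<zero> (C \<times>\<^sub>o A) A)\<rangle> \<cdot>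
      L C A (\<langle>\<pi>\<^sub>0 C A, \<pi>\<^sub>1 C A \<^bold>+ \<langle>\<pi>\<^sub>0 C A, \<zero> (C \<times>\<^sub>o A) A\<rangle> \<cdot> \<zero> (C \<times>\<^sub>o A) A\<rangle> \<cdot> ?g)"
    by (rule LS5[of _ _ _ _ _ B]) (simp_all add: hom_def calc)
  also have "\<dots> = \<zero> (C \<times>\<^sub>o A) B"
    by (subst LS1_zer, simp_all, rule L_at_zer) (simp_all add: hom_def calc)
  finally show ?thesis by (simp add: calc)
qed

text \<open>
  A linear k vanishes at 0, so the translation by k(c,0) in the chain rule \<open>LS5\<close> disappears.
\<close>

lemma L_precomp_linear:
  assumes "C \<in> Ob X" "A \<in> Ob X" "k \<in> hom X (C \<times>\<^sub>o A) B" "L C A k = k"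
    and "g \<in> hom X (C \<times>\<^sub>o B) B'"
  shows "L C A (\<langle>\<pi>\<^sub>0 C A, k\<rangle> \<cdot> g) = \<langle>\<pi>\<^sub>0 C A, k\<rangle> \<cdot> L C B g"
proof -
  note [simp] = assms(1,2) homD[OF assms(3)] assms(4) homD[OF assms(5)]
  have [simp]: "B \<in> Ob X" using tgt_Ob[of k] by simp
  have "\<langle>\<pi>\<^sub>0 C B, \<zero> (C \<times>\<^sub>o B) A\<rangle> \<cdot> k = \<zero> (C \<times>\<^sub>o B) B"
    using L_at_zer[OF assms(2,3), of "\<pi>\<^sub>0 C B" "C \<times>\<^sub>o B"] by (simp add: hom_def calc)
  then show ?thesis
    using LS5[of C A B k g B'] assms by (simp add: calc)
qed

text \<open>
  In the chain rule \<open>LS5\<close> the outer function is g(c, b + k(c,0)) = g(c,b) + g(c, k(c,0)), by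
  additivity of the linear g; the second summand is constant in b.
\<close>

lemma L_postcomp_linear:
  assumes "C \<in> Ob X" "A \<in> Ob X" "k \<in> hom X (C \<times>\<^sub>o A) B"
    and "g \<in> hom X (C \<times>\<^sub>o B) B'" "L C B g = g"
  shows "L C A (\<langle>\<pi>\<^sub>0 C A, k\<rangle> \<cdot> g) = \<langle>\<pi>\<^sub>0 C A, L C A k\<rangle> \<cdot> g"
proof -
  note [simp] = assms(1,2) homD[OF assms(3)] homD[OF assms(4)]
  have [simp]: "B \<in> Ob X" "B' \<in> Ob X" using tgt_Ob[of k] tgt_Ob[of g] by simp_all
  \<comment> \<open>\<open>?u\<close> is c \<mapsto> g(c, k(c,0)), the summand constant in the linearized argument.\<close>
  let ?u = "\<langle>\<one> C, \<langle>\<one> C, \<zero> C A\<rangle> \<cdot> k\<rangle> \<cdot> g"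
  have u: "\<langle>\<pi>\<^sub>0 C B, \<langle>\<pi>\<^sub>0 C B, \<zero> (C \<times>\<^sub>o B) A\<rangle> \<cdot> k\<rangle> \<cdot> g = \<pi>\<^sub>0 C B \<cdot> ?u"
    by (simp add: calc)
  have "\<langle>\<pi>\<^sub>0 C B, \<pi>\<^sub>1 C B \<^bold>+ \<langle>\<pi>\<^sub>0 C B, \<zero> (C \<times>\<^sub>o B) A\<rangle> \<cdot> k\<rangle> \<cdot> g = g \<^bold>+ \<pi>\<^sub>0 C B \<cdot> ?u"
    unfolding u[symmetric]
    using L_at_add[OF assms(4), of "\<pi>\<^sub>0 C B" "C \<times>\<^sub>o B" "\<pi>\<^sub>1 C B"
        "\<langle>\<pi>\<^sub>0 C B, \<zero> (C \<times>\<^sub>o B) A\<rangle> \<cdot> k"]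
    by (simp add: assms(5) hom_def calc)
  moreover have "L C B (g \<^bold>+ \<pi>\<^sub>0 C B \<cdot> ?u) = g"
    using LS1_add[OF assms(1) _ assms(4), of "\<pi>\<^sub>0 C B \<cdot> ?u"] L_const[of C B ?u B']
    by (simp add: assms(5) hom_def typing add_zer')
  ultimately show ?thesis
    using LS5[of C A B k g B'] assms by simp
qed

text \<open>
  \<open>LS8\<close> in the form taken by h \<times> 1 once product maps are unfolded to pairings.
\<close>

lemma L_at_reindex:
  assumes "C \<in> Ob X" "A \<in> Ob X" "f \<in> hom X (C \<times>\<^sub>o A) B" "h \<in> hom X C' C"
  shows "L C' A (\<langle>\<pi>\<^sub>0 C' A \<cdot> h, \<pi>\<^sub>1 C' A\<rangle> \<cdot> f) = \<langle>\<pi>\<^sub>0 C' A \<cdot> h, \<pi>\<^sub>1 C' A\<rangle> \<cdot> L C A f"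
proof -
  note [simp] = assms(1,2) homD[OF assms(3)] homD[OF assms(4)]
  have [simp]: "C' \<in> Ob X" using src_Ob[of h] by simp
  show ?thesis
    using LS8[OF assms(1,2,4,3)] by (simp add: calc)
qed

end

section \<open>The induced linearizing combinator\<close>

context linearizing_system
begin

abbreviation "L0 \<equiv> induced_L X L"

lemma L0_eq: "f \<in> hom X A B \<Longrightarrow> L0 f = \<langle>\<zero> A \<top>, \<one> A\<rangle> \<cdot> L \<top> A (\<pi>\<^sub>1 \<top> A \<cdot> f)"
  by (simp add: induced_L_def hom_def)

lemma L0_typing:
  assumes "f \<in> Ar X"
  shows "L0 f \<in> Ar X" "src X (L0 f) = src X f" "tgt X (L0 f) = tgt X f"
  using assms src_Ob[OF assms] by (simp_all add: induced_L_def Let_def typing L_typing)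

text \<open>
  A map without parameters linearizes in the same way over every C, by changing parameters along
  the unique map C \<rightarrow> \<top>.
\<close>

lemma L_prj1:
  assumes "C \<in> Ob X" "f \<in> hom X A B"
  shows "L C A (\<pi>\<^sub>1 C A \<cdot> f) = \<pi>\<^sub>1 C A \<cdot> L0 f"
proof -
  note [simp] = assms(1) homD[OF assms(2)]
  have [simp]: "A \<in> Ob X" using src_Ob[of f] by simp
  show ?thesis
    using L_at_reindex[of \<top> A "\<pi>\<^sub>1 \<top> A \<cdot> f" B "\<zero> C \<top>" C] L0_eq[OF assms(2)]
    by (simp add: calc hom_def L_typing)
qed

lemma linearizing_combinator_L0: "linearizing_combinator X L0"
proof unfold_locales
  fix f A B assume f: "f \<in> hom X A B"
  then show "L0 f \<in> hom X A B" by (simp add: hom_def L0_typing)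
next
  fix f g A B assume f: "f \<in> hom X A B" and g: "g \<in> hom X A B"
  note [simp] = homD[OF f] homD[OF g]
  have [simp]: "A \<in> Ob X" using src_Ob[of f] by simp
  show "L0 (f \<^bold>+ g) = L0 f \<^bold>+ L0 g"
    using LS1_add[of \<top> A "\<pi>\<^sub>1 \<top> A \<cdot> f" B "\<pi>\<^sub>1 \<top> A \<cdot> g"]
    by (simp add: induced_L_def calc hom_def L_typing)
next
  fix A B assume [simp]: "A \<in> Ob X" "B \<in> Ob X"
  show "L0 (\<zero> A B) = \<zero> A B"
    by (simp add: induced_L_def calc LS1_zer)
next
  fix f A B assume f: "f \<in> hom X A B"
  note [simp] = homD[OF f]
  have [simp]: "A \<in> Ob X" using src_Ob[of f] by simp
  let ?F = "\<pi>\<^sub>1 \<top> A \<cdot> f"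
  have F: "?F \<in> hom X (\<top> \<times>\<^sub>o A) B" by (simp add: hom_def calc)
  have at: "x \<cdot> L0 f = \<langle>\<zero> Z \<top>, x\<rangle> \<cdot> L \<top> A ?F" if "x \<in> hom X Z A" for x Z
    using homD[OF that] L0_eq[OF f] by (simp add: calc L_typing)
  have "\<zero> Z A \<cdot> L0 f = \<zero> Z B" if "Z \<in> Ob X" for Z
    using at[OF zer_hom] L_at_zer[OF _ F zer_hom] that by (simp add: trm_Ob)
  moreover have "(g \<^bold>+ h) \<cdot> L0 f = g \<cdot> L0 f \<^bold>+ h \<cdot> L0 f"
    if "Z \<in> Ob X" "g \<in> hom X Z A" "h \<in> hom X Z A" for Z g h
    using at[OF add_hom[OF that(2,3)]] at[OF that(2)] at[OF that(3)]
      L_at_add[OF F zer_hom that(2,3)] that(1) by (simp add: trm_Ob)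
  ultimately show "additive_arrow X (L0 f)"
    by (simp add: additive_arrow_def L0_typing)
next
  fix A assume [simp]: "A \<in> Ob X"
  show "L0 (\<one> A) = \<one> A"
    by (simp add: induced_L_def calc LS3_idn)
next
  fix A B assume [simp]: "A \<in> Ob X" "B \<in> Ob X"
  show "L0 (\<pi>\<^sub>0 A B) = \<pi>\<^sub>0 A B" "L0 (\<pi>\<^sub>1 A B) = \<pi>\<^sub>1 A B"
    by (simp_all add: induced_L_def calc LS3_prj0 LS3_prj1)
next
  fix f g C A B assume f: "f \<in> hom X C A" and g: "g \<in> hom X C B"
  note [simp] = homD[OF f] homD[OF g]
  have [simp]: "C \<in> Ob X" using src_Ob[of f] by simp
  show "L0 \<langle>f, g\<rangle> = \<langle>L0 f, L0 g\<rangle>"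
    using LS4[of \<top> C "\<pi>\<^sub>1 \<top> C \<cdot> f" A "\<pi>\<^sub>1 \<top> C \<cdot> g" B]
    by (simp add: induced_L_def calc hom_def L_typing)
next
  fix f g A B C assume f: "f \<in> hom X A B" and g: "g \<in> hom X B C"
  note [simp] = homD[OF f] homD[OF g]
  have [simp]: "A \<in> Ob X" "B \<in> Ob X" using src_Ob[of f] tgt_Ob[of f] by simp_all
  show "L0 (f \<cdot> g) = L0 f \<cdot> L0 ((\<one> B \<^bold>+ \<zero> B A \<cdot> f) \<cdot> g)"
    using LS5[of \<top> A B "\<pi>\<^sub>1 \<top> A \<cdot> f" "\<pi>\<^sub>1 \<top> B \<cdot> g" C]
    by (simp add: induced_L_def calc hom_def L_typing)
next
  fix f A B assume f: "f \<in> hom X A B"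
  note [simp] = homD[OF f]
  have [simp]: "A \<in> Ob X" using src_Ob[of f] by simp
  \<comment> \<open>The passages from and to \<top> \<times> A between the two linearizations cancel.\<close>
  have "\<langle>\<zero> (\<top> \<times>\<^sub>o A) \<top>, \<pi>\<^sub>1 \<top> A\<rangle> = \<one> (\<top> \<times>\<^sub>o A)"
    using pairing_prjs[of \<top> A] by (simp add: prj0_trm trm_Ob)
  then show "L0 (L0 f) = L0 f"
    using LS6[of \<top> A "\<pi>\<^sub>1 \<top> A \<cdot> f" B]
    by (simp add: induced_L_def calc hom_def L_typing)
qed

end

section \<open>The induced differential combinator\<close>

context linearizing_system
begin

abbreviation "DL \<equiv> induced_D X L"

lemma DL_eq: "f \<in> hom X A B \<Longrightarrow> DL f = L A A (\<oplus> A \<cdot> f)"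
  by (simp add: induced_D_def hom_def)

lemma DL_typing:
  assumes "f \<in> Ar X"
  shows "DL f \<in> Ar X" "src X (DL f) = src X f \<times>\<^sub>o src X f" "tgt X (DL f) = tgt X f"
  using assms src_Ob[OF assms] by (simp_all add: induced_D_def Let_def codiag_def typing L_typing)

text \<open>
  Linearizing f(h(c) + a) in a is differentiating f at the base point h(c): change of parameter
  along h.
\<close>

lemma DL_reindex:
  assumes "f \<in> hom X A B" "h \<in> hom X C A"
  shows "L C A ((\<pi>\<^sub>0 C A \<cdot> h \<^bold>+ \<pi>\<^sub>1 C A) \<cdot> f) = \<langle>\<pi>\<^sub>0 C A \<cdot> h, \<pi>\<^sub>1 C A\<rangle> \<cdot> DL f"
proof -
  note [simp] = homD[OF assms(1)] homD[OF assms(2)]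
  have [simp]: "A \<in> Ob X" "C \<in> Ob X" using src_Ob[of f] src_Ob[of h] by simp_all
  show ?thesis
    using L_at_reindex[of A A "\<oplus> A \<cdot> f" B h C]
    by (simp add: DL_eq[OF assms(1)] calc hom_def)
qed

text \<open>
  The derivative at c in a direction k depending linearly on v is itself a linearization in v,
  now of f(c + k).  For an injection k this exhibits partial derivatives as partial linearizations.
\<close>

lemma DL_along_linear:
  assumes "f \<in> hom X C B" "C \<in> Ob X" "V \<in> Ob X" "k \<in> hom X (C \<times>\<^sub>o V) C" "L C V k = k"
  shows "\<langle>\<pi>\<^sub>0 C V, k\<rangle> \<cdot> DL f = L C V ((\<pi>\<^sub>0 C V \<^bold>+ k) \<cdot> f)"
proof -
  note [simp] = homD[OF assms(1)] assms(2,3) homD[OF assms(4)]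
  show ?thesis
    using L_precomp_linear[OF assms(2-5), of "\<oplus> C \<cdot> f" B]
    by (simp add: DL_eq[OF assms(1)] calc hom_def)
qed

text \<open>
  For additive f, f(a + v) = f(a) + f(v), and only the second summand depends on v.
\<close>

lemma DL_linear:
  assumes f: "f \<in> hom X A B" and add: "additive_arrow X f"
    and lin: "L A A (\<pi>\<^sub>1 A A \<cdot> f) = \<pi>\<^sub>1 A A \<cdot> f"
  shows "DL f = \<pi>\<^sub>1 A A \<cdot> f"
proof -
  note [simp] = homD[OF f]
  have [simp]: "A \<in> Ob X" "B \<in> Ob X" using src_Ob[of f] tgt_Ob[of f] by simp_all
  have "(\<pi>\<^sub>0 A A \<^bold>+ \<pi>\<^sub>1 A A) \<cdot> f = \<pi>\<^sub>0 A A \<cdot> f \<^bold>+ \<pi>\<^sub>1 A A \<cdot> f"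
    using add prd_Ob[of A A] prj0_hom[of A A] prj1_hom[of A A]
    unfolding additive_arrow_def by simp
  moreover have "L A A (\<pi>\<^sub>0 A A \<cdot> f \<^bold>+ \<pi>\<^sub>1 A A \<cdot> f) = L A A (\<pi>\<^sub>0 A A \<cdot> f) \<^bold>+ L A A (\<pi>\<^sub>1 A A \<cdot> f)"
    by (rule LS1_add[where B=B]) (simp_all add: hom_def typing)
  ultimately show ?thesis
    by (simp add: DL_eq[OF f] codiag_def L_const[OF _ _ f] lin typing zer_add')
qed

text \<open>
  The directions (0,b) and (b,0) are linear in b, which makes \<open>DL_along_linear\<close> and
  \<open>L_precomp_linear\<close> applicable to partial derivatives.
\<close>

lemma L_injections:
  assumes [simp]: "C \<in> Ob X" "A \<in> Ob X" "B \<in> Ob X"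
  shows "L C B \<langle>\<zero> (C \<times>\<^sub>o B) A, \<pi>\<^sub>1 C B\<rangle> = \<langle>\<zero> (C \<times>\<^sub>o B) A, \<pi>\<^sub>1 C B\<rangle>"
    and "L C B \<langle>\<pi>\<^sub>1 C B, \<zero> (C \<times>\<^sub>o B) A\<rangle> = \<langle>\<pi>\<^sub>1 C B, \<zero> (C \<times>\<^sub>o B) A\<rangle>"
  by (simp_all add: LS4[where B=A and B'=B] LS4[where B=B and B'=A] LS1_zer LS3_idn
      zer_hom prj1_hom prd_Ob)

text \<open>
  Both sides are double linearizations of f(a + b + v) on A \<times> (A \<times> A).  Linearizing in the last
  variable and then in the middle one gives E through \<open>beta\<close>; the other order gives E through
  \<open>alpha\<close>, because the sum is symmetric.  \<open>LS7\<close> identifies them.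
\<close>

lemma DL_DL_symmetric:
  assumes f: "f \<in> hom X A B"
    and a: "a \<in> hom X Z A" and b: "b \<in> hom X Z A" and v: "v \<in> hom X Z A"
  defines "P \<equiv> A \<times>\<^sub>o A"
  defines "E \<equiv> L P A (\<langle>\<pi>\<^sub>0 P A \<cdot> \<pi>\<^sub>0 A A \<^bold>+ \<pi>\<^sub>1 P A, \<pi>\<^sub>0 P A \<cdot> \<pi>\<^sub>1 A A\<rangle> \<cdot> DL f)"
  shows "\<langle>\<langle>a, b\<rangle>, v\<rangle> \<cdot> E = \<langle>\<langle>a, v\<rangle>, b\<rangle> \<cdot> E"
proof -
  note [simp] = homD[OF f] homD[OF a] homD[OF b] homD[OF v]
  have A [simp]: "A \<in> Ob X" using src_Ob[of f] by simp
  have P [simp]: "P \<in> Ob X" by (simp add: P_def prd_Ob)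
  let ?s = "\<pi>\<^sub>0 A P \<^bold>+ (\<pi>\<^sub>1 A P \<cdot> \<pi>\<^sub>0 A A \<^bold>+ \<pi>\<^sub>1 A P \<cdot> \<pi>\<^sub>1 A A)"
  have F: "?s \<cdot> f \<in> hom X (A \<times>\<^sub>o P) B"
    by (simp add: hom_def typing P_def)
  have DP: "L P A ((\<pi>\<^sub>0 P A \<cdot> (\<pi>\<^sub>0 A A \<^bold>+ \<pi>\<^sub>1 A A) \<^bold>+ \<pi>\<^sub>1 P A) \<cdot> f) =
      \<langle>\<pi>\<^sub>0 P A \<cdot> (\<pi>\<^sub>0 A A \<^bold>+ \<pi>\<^sub>1 A A), \<pi>\<^sub>1 P A\<rangle> \<cdot> DL f"
    by (rule DL_reindex[OF f]) (simp add: hom_def typing P_def)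
  have snd: "LS_snd X L A A A (?s \<cdot> f) =
      \<langle>\<pi>\<^sub>0 A P \<^bold>+ \<pi>\<^sub>1 A P \<cdot> \<pi>\<^sub>0 A A, \<pi>\<^sub>1 A P \<cdot> \<pi>\<^sub>1 A A\<rangle> \<cdot> DL f"
    unfolding LS_snd_def inverse_alpha[OF A A A]
    using DP by (simp add: P_def alpha_def calc add_ac DL_typing)
  have fst: "LS_fst X L A A A (?s \<cdot> f) =
      \<langle>\<pi>\<^sub>0 A P \<^bold>+ \<pi>\<^sub>1 A P \<cdot> \<pi>\<^sub>1 A A, \<pi>\<^sub>1 A P \<cdot> \<pi>\<^sub>0 A A\<rangle> \<cdot> DL f"
    unfolding LS_fst_def inverse_beta[OF A A A]
    using DP by (simp add: P_def beta_def calc add_ac DL_typing)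
  have "beta X A A A \<cdot> E = alpha X A A A \<cdot> E"
    using LS7[OF A A A, of "?s \<cdot> f" B] F
    unfolding snd fst unfolding P_def[symmetric]
    unfolding LS_fst_def LS_snd_def inverse_alpha[OF A A A] inverse_beta[OF A A A]
    by (simp add: P_def E_def calc DL_typing)
  then have "\<langle>a, \<langle>b, v\<rangle>\<rangle> \<cdot> (beta X A A A \<cdot> E) = \<langle>a, \<langle>b, v\<rangle>\<rangle> \<cdot> (alpha X A A A \<cdot> E)"
    by simp
  moreover have "E \<in> hom X (P \<times>\<^sub>o A) B"
    by (simp add: E_def P_def hom_def typing L_typing DL_typing)
  ultimately show ?thesis
    by (simp add: P_def alpha_def beta_def calc hom_def)
qed

text \<open>
  The second derivative is additive in its direction (b,w) = (b,0) + (0,w).  Along (b,0) it is the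
  linearization E of D[f](a + b, v) in b.  Along (0,w) it is the linearization in w of
  D[f](a, v + w) = D[f](a,v) + D[f](a,w), whose first summand is constant and whose second is
  already linear in w.
\<close>

lemma DL_DL_split:
  assumes f: "f \<in> hom X A B"
  defines "P \<equiv> A \<times>\<^sub>o A"
  defines "E \<equiv> L P A (\<langle>\<pi>\<^sub>0 P A \<cdot> \<pi>\<^sub>0 A A \<^bold>+ \<pi>\<^sub>1 P A, \<pi>\<^sub>0 P A \<cdot> \<pi>\<^sub>1 A A\<rangle> \<cdot> DL f)"
  shows "DL (DL f) = \<langle>\<pi>\<^sub>0 P P, \<pi>\<^sub>1 P P \<cdot> \<pi>\<^sub>0 A A\<rangle> \<cdot> E \<^bold>+
      \<langle>\<pi>\<^sub>0 P P \<cdot> \<pi>\<^sub>0 A A, \<pi>\<^sub>1 P P \<cdot> \<pi>\<^sub>1 A A\<rangle> \<cdot> DL f"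
proof -
  note [simp] = homD[OF f]
  have A [simp]: "A \<in> Ob X" and B [simp]: "B \<in> Ob X"
    using src_Ob[of f] tgt_Ob[of f] by simp_all
  have P [simp]: "P \<in> Ob X" by (simp add: P_def prd_Ob)
  have D: "DL f \<in> hom X P B" by (simp add: hom_def DL_typing P_def)
  let ?b = "\<pi>\<^sub>1 P P \<cdot> \<pi>\<^sub>0 A A" and ?w = "\<pi>\<^sub>1 P P \<cdot> \<pi>\<^sub>1 A A" and ?z = "\<zero> (P \<times>\<^sub>o P) A"
  have "DL (DL f) = \<langle>\<pi>\<^sub>0 P P, \<langle>?b, ?z\<rangle> \<^bold>+ \<langle>?z, ?w\<rangle>\<rangle> \<cdot> DL (DL f)"
    by (simp add: P_def calc DL_typing)
  also have "\<dots> = \<langle>\<pi>\<^sub>0 P P, \<langle>?b, ?z\<rangle>\<rangle> \<cdot> DL (DL f) \<^bold>+ \<langle>\<pi>\<^sub>0 P P, \<langle>?z, ?w\<rangle>\<rangle> \<cdot> DL (DL f)"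
    unfolding DL_eq[OF D]
    by (rule L_at_add[where B=B]) (simp_all add: P_def hom_def calc DL_typing)
  also have "\<langle>\<pi>\<^sub>0 P P, \<langle>?b, ?z\<rangle>\<rangle> \<cdot> DL (DL f) = \<langle>\<pi>\<^sub>0 P P, ?b\<rangle> \<cdot> E"
  proof -
    have "\<langle>\<pi>\<^sub>0 P A, \<langle>\<pi>\<^sub>1 P A, \<zero> (P \<times>\<^sub>o A) A\<rangle>\<rangle> \<cdot> DL (DL f) =
        L P A ((\<pi>\<^sub>0 P A \<^bold>+ \<langle>\<pi>\<^sub>1 P A, \<zero> (P \<times>\<^sub>o A) A\<rangle>) \<cdot> DL f)"
      by (rule DL_along_linear[OF D P A])
        (simp_all add: L_injections, simp add: P_def hom_def calc)
    also have "\<pi>\<^sub>0 P A \<^bold>+ \<langle>\<pi>\<^sub>1 P A, \<zero> (P \<times>\<^sub>o A) A\<rangle> =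
        \<langle>\<pi>\<^sub>0 P A \<cdot> \<pi>\<^sub>0 A A \<^bold>+ \<pi>\<^sub>1 P A, \<pi>\<^sub>0 P A \<cdot> \<pi>\<^sub>1 A A\<rangle>"
      by (rule pairing_ext[of A A]) (simp_all add: P_def calc)
    finally have "\<langle>\<pi>\<^sub>0 P P, ?b\<rangle> \<cdot>
        (\<langle>\<pi>\<^sub>0 P A, \<langle>\<pi>\<^sub>1 P A, \<zero> (P \<times>\<^sub>o A) A\<rangle>\<rangle> \<cdot> DL (DL f)) = \<langle>\<pi>\<^sub>0 P P, ?b\<rangle> \<cdot> E"
      by (simp add: E_def)
    then show ?thesis by (simp add: P_def calc DL_typing)
  qed
  also have "\<langle>\<pi>\<^sub>0 P P, \<langle>?z, ?w\<rangle>\<rangle> \<cdot> DL (DL f) = \<langle>\<pi>\<^sub>0 P P \<cdot> \<pi>\<^sub>0 A A, ?w\<rangle> \<cdot> DL f"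
  proof -
    let ?D = "\<langle>\<pi>\<^sub>0 P A \<cdot> \<pi>\<^sub>0 A A, \<pi>\<^sub>1 P A\<rangle> \<cdot> DL f"
    have "\<langle>\<pi>\<^sub>0 P A, \<langle>\<zero> (P \<times>\<^sub>o A) A, \<pi>\<^sub>1 P A\<rangle>\<rangle> \<cdot> DL (DL f) =
        L P A ((\<pi>\<^sub>0 P A \<^bold>+ \<langle>\<zero> (P \<times>\<^sub>o A) A, \<pi>\<^sub>1 P A\<rangle>) \<cdot> DL f)"
      by (rule DL_along_linear[OF D P A])
        (simp_all add: L_injections, simp add: P_def hom_def calc)
    also have "\<pi>\<^sub>0 P A \<^bold>+ \<langle>\<zero> (P \<times>\<^sub>o A) A, \<pi>\<^sub>1 P A\<rangle> =
        \<langle>\<pi>\<^sub>0 P A \<cdot> \<pi>\<^sub>0 A A, \<pi>\<^sub>0 P A \<cdot> \<pi>\<^sub>1 A A \<^bold>+ \<pi>\<^sub>1 P A\<rangle>"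
      by (rule pairing_ext[of A A]) (simp_all add: P_def calc)
    also have "\<dots> \<cdot> DL f = \<langle>\<pi>\<^sub>0 P A \<cdot> \<pi>\<^sub>0 A A, \<pi>\<^sub>0 P A \<cdot> \<pi>\<^sub>1 A A\<rangle> \<cdot> DL f \<^bold>+ ?D"
      unfolding DL_eq[OF f]
      by (rule L_at_add[where B=B]) (simp_all add: P_def hom_def calc)
    also have "\<langle>\<pi>\<^sub>0 P A \<cdot> \<pi>\<^sub>0 A A, \<pi>\<^sub>0 P A \<cdot> \<pi>\<^sub>1 A A\<rangle> = \<pi>\<^sub>0 P A"
      by (simp add: P_def calc)
    also have "L P A (\<pi>\<^sub>0 P A \<cdot> DL f \<^bold>+ ?D) = L P A (\<pi>\<^sub>0 P A \<cdot> DL f) \<^bold>+ L P A ?D"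
      by (rule LS1_add[where B=B]) (simp_all add: P_def hom_def calc DL_typing)
    also have "L P A (\<pi>\<^sub>0 P A \<cdot> DL f) = \<zero> (P \<times>\<^sub>o A) B"
      by (rule L_const[OF P A D])
    also have "L P A ?D = \<langle>\<pi>\<^sub>0 P A \<cdot> \<pi>\<^sub>0 A A, \<pi>\<^sub>1 P A\<rangle> \<cdot> L A A (DL f)"
      by (rule L_at_reindex[where B=B]) (simp_all add: P_def hom_def typing DL_typing)
    also have "L A A (DL f) = DL f"
      unfolding DL_eq[OF f]
      by (rule LS6[where B=B]) (simp_all add: hom_def calc)
    also have "\<zero> (P \<times>\<^sub>o A) B \<^bold>+ ?D = ?D"
      by (simp add: P_def calc DL_typing)
    finally have "\<langle>\<pi>\<^sub>0 P P, ?w\<rangle> \<cdot> (\<langle>\<pi>\<^sub>0 P A, \<langle>\<zero> (P \<times>\<^sub>o A) A, \<pi>\<^sub>1 P A\<rangle>\<rangle> \<cdot> DL (DL f)) =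
        \<langle>\<pi>\<^sub>0 P P, ?w\<rangle> \<cdot> ?D"
      by simp
    then show ?thesis by (simp add: P_def calc DL_typing)
  qed
  finally show ?thesis .
qed

lemma differential_combinator_DL: "differential_combinator X DL"
proof unfold_locales
  fix f A B assume "f \<in> hom X A B"
  then show "DL f \<in> hom X (A \<times>\<^sub>o A) B" by (simp add: hom_def DL_typing)
next
  fix f g A B assume f: "f \<in> hom X A B" and g: "g \<in> hom X A B"
  note [simp] = homD[OF f] homD[OF g]
  have [simp]: "A \<in> Ob X" using src_Ob[of f] by simp
  show "DL (f \<^bold>+ g) = DL f \<^bold>+ DL g"
    using LS1_add[of A A "\<oplus> A \<cdot> f" B "\<oplus> A \<cdot> g"]
    by (simp add: induced_D_def calc hom_def)
next
  fix A B assume [simp]: "A \<in> Ob X" "B \<in> Ob X"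
  show "DL (\<zero> A B) = \<zero> (A \<times>\<^sub>o A) B"
    by (simp add: induced_D_def calc LS1_zer)
next
  fix f A B assume f: "f \<in> hom X A B"
  note [simp] = homD[OF f]
  have [simp]: "A \<in> Ob X" using src_Ob[of f] by simp
  have F: "\<oplus> A \<cdot> f \<in> hom X (A \<times>\<^sub>o A) B" by (simp add: hom_def calc)
  show "(\<one> A \<times>\<^sub>m \<oplus> A) \<cdot> DL f = (\<one> A \<times>\<^sub>m \<pi>\<^sub>0 A A) \<cdot> DL f \<^bold>+ (\<one> A \<times>\<^sub>m \<pi>\<^sub>1 A A) \<cdot> DL f"
    unfolding DL_eq[OF f] by (rule LS2_add[OF _ _ F]) simp_all
  show "\<langle>\<one> A, \<zero> A A\<rangle> \<cdot> DL f = \<zero> A B"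
    unfolding DL_eq[OF f] by (rule L_at_zer[OF _ F]) (simp_all add: idn_hom)
next
  fix A assume [simp]: "A \<in> Ob X"
  show "DL (\<one> A) = \<pi>\<^sub>1 A A"
    using DL_linear[of "\<one> A" A A]
    by (simp add: additive_arrow_def hom_def calc LS3_idn)
next
  fix A B assume [simp]: "A \<in> Ob X" "B \<in> Ob X"
  show "DL (\<pi>\<^sub>0 A B) = \<pi>\<^sub>1 (A \<times>\<^sub>o B) (A \<times>\<^sub>o B) \<cdot> \<pi>\<^sub>0 A B"
    by (rule DL_linear[where B=A]) (simp_all add: prj0_hom prj0_additive LS3_prj0 prd_Ob)
  show "DL (\<pi>\<^sub>1 A B) = \<pi>\<^sub>1 (A \<times>\<^sub>o B) (A \<times>\<^sub>o B) \<cdot> \<pi>\<^sub>1 A B"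
    by (rule DL_linear[where B=B]) (simp_all add: prj1_hom prj1_additive LS3_prj1 prd_Ob)
next
  fix f g C A B assume f: "f \<in> hom X C A" and g: "g \<in> hom X C B"
  note [simp] = homD[OF f] homD[OF g]
  have [simp]: "C \<in> Ob X" using src_Ob[of f] by simp
  show "DL \<langle>f, g\<rangle> = \<langle>DL f, DL g\<rangle>"
    using LS4[of C C "\<oplus> C \<cdot> f" A "\<oplus> C \<cdot> g" B]
    by (simp add: induced_D_def calc hom_def)
next
  fix f g A B C assume f: "f \<in> hom X A B" and g: "g \<in> hom X B C"
  note [simp] = homD[OF f] homD[OF g]
  have [simp]: "A \<in> Ob X" "B \<in> Ob X" using src_Ob[of f] src_Ob[of g] by simp_all
  \<comment> \<open>At v = 0 the inner map f(a + v) is f(a), so the outer linearization is of g translated to f(a).\<close>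
  have "L A A (\<langle>\<pi>\<^sub>0 A A, \<oplus> A \<cdot> f\<rangle> \<cdot> (\<pi>\<^sub>1 A B \<cdot> g)) = \<langle>\<pi>\<^sub>0 A A, DL f\<rangle> \<cdot>
      L A B (\<langle>\<pi>\<^sub>0 A B, \<pi>\<^sub>1 A B \<^bold>+ \<langle>\<pi>\<^sub>0 A B, \<zero> (A \<times>\<^sub>o B) A\<rangle> \<cdot> (\<oplus> A \<cdot> f)\<rangle> \<cdot> (\<pi>\<^sub>1 A B \<cdot> g))"
    unfolding DL_eq[OF f] by (rule LS5) (simp_all add: hom_def calc)
  also have "\<langle>\<pi>\<^sub>0 A B, \<pi>\<^sub>1 A B \<^bold>+ \<langle>\<pi>\<^sub>0 A B, \<zero> (A \<times>\<^sub>o B) A\<rangle> \<cdot> (\<oplus> A \<cdot> f)\<rangle> \<cdot> (\<pi>\<^sub>1 A B \<cdot> g) =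
      (\<pi>\<^sub>0 A B \<cdot> f \<^bold>+ \<pi>\<^sub>1 A B) \<cdot> g"
    by (simp add: calc add_ac)
  also have "L A B \<dots> = \<langle>\<pi>\<^sub>0 A B \<cdot> f, \<pi>\<^sub>1 A B\<rangle> \<cdot> DL g"
    by (rule DL_reindex[OF g f])
  finally show "DL (f \<cdot> g) = \<langle>\<pi>\<^sub>0 A A \<cdot> f, DL f\<rangle> \<cdot> DL g"
    by (simp add: induced_D_def[of _ _ "f \<cdot> g"] calc DL_typing)
next
  fix f A B assume f: "f \<in> hom X A B"
  note [simp] = homD[OF f]
  have [simp]: "A \<in> Ob X" using src_Ob[of f] by simp
  let ?P = "A \<times>\<^sub>o A"
  let ?k = "\<langle>\<zero> ?P A, \<pi>\<^sub>1 A A\<rangle>"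
  have D: "DL f \<in> hom X ?P B" by (simp add: hom_def DL_typing)
  \<comment> \<open>At the base point (a,0) and in direction (0,w), linearizing D[f](a,w) in w gives D[f](a,w)
    back, by idempotence.\<close>
  have "\<langle>\<pi>\<^sub>0 A ?P \<cdot> \<langle>\<one> A, \<zero> A A\<rangle>, \<pi>\<^sub>1 A ?P\<rangle> \<cdot> DL (DL f) =
      L A ?P ((\<pi>\<^sub>0 A ?P \<cdot> \<langle>\<one> A, \<zero> A A\<rangle> \<^bold>+ \<pi>\<^sub>1 A ?P) \<cdot> DL f)" (is "_ = L A ?P ?G")
    by (rule DL_reindex[OF D, symmetric]) (simp add: hom_def calc)
  then have "\<langle>\<pi>\<^sub>0 A A, ?k\<rangle> \<cdot> (\<langle>\<pi>\<^sub>0 A ?P \<cdot> \<langle>\<one> A, \<zero> A A\<rangle>, \<pi>\<^sub>1 A ?P\<rangle> \<cdot> DL (DL f)) =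
      \<langle>\<pi>\<^sub>0 A A, ?k\<rangle> \<cdot> L A ?P ?G"
    by simp
  also have "\<dots> = L A A (\<langle>\<pi>\<^sub>0 A A, ?k\<rangle> \<cdot> ?G)"
    by (rule L_precomp_linear[symmetric, where B'=B])
      (simp_all add: L_injections hom_def calc DL_typing)
  also have "\<langle>\<pi>\<^sub>0 A A, ?k\<rangle> \<cdot> ?G = DL f"
    by (simp add: calc DL_typing)
  also have "L A A (DL f) = DL f"
    unfolding DL_eq[OF f] by (rule LS6[where B=B]) (simp_all add: hom_def calc)
  finally show "vlift X A A A A \<cdot> DL (DL f) = DL f"
    by (simp add: vlift_def calc DL_typing)
next
  fix f A B assume f: "f \<in> hom X A B"
  note [simp] = homD[OF f]
  have [simp]: "A \<in> Ob X" using src_Ob[of f] by simp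
  let ?P = "A \<times>\<^sub>o A"
  let ?E = "L ?P A (\<langle>\<pi>\<^sub>0 ?P A \<cdot> \<pi>\<^sub>0 A A \<^bold>+ \<pi>\<^sub>1 ?P A, \<pi>\<^sub>0 ?P A \<cdot> \<pi>\<^sub>1 A A\<rangle> \<cdot> DL f)"
  define E where "E = ?E"
  have E: "E \<in> Ar X" "src X E = ?P \<times>\<^sub>o A" "tgt X E = B"
    by (simp_all add: E_def typing DL_typing L_typing)
  let ?a = "\<pi>\<^sub>0 ?P ?P \<cdot> \<pi>\<^sub>0 A A" and ?b = "\<pi>\<^sub>1 ?P ?P \<cdot> \<pi>\<^sub>0 A A"
    and ?v = "\<pi>\<^sub>0 ?P ?P \<cdot> \<pi>\<^sub>1 A A"
  have "\<langle>\<langle>?a, ?b\<rangle>, ?v\<rangle> \<cdot> E = \<langle>\<langle>?a, ?v\<rangle>, ?b\<rangle> \<cdot> E"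
    unfolding E_def by (rule DL_DL_symmetric[OF f]) (simp_all add: hom_def typing)
  then show "interchange X A A A A \<cdot> DL (DL f) = DL (DL f)"
    unfolding DL_DL_split[OF f] E_def[symmetric]
    by (simp add: interchange_def calc E DL_typing)
qed

end

section \<open>Closed systems\<close>

context cc_left_additive_category
begin

lemma ev_typing:
  assumes "C \<in> Ob X" "A \<in> Ob X"
  shows "\<epsilon> C A \<in> Ar X" "src X (\<epsilon> C A) = C \<times>\<^sub>o (C \<Rrightarrow> A)" "tgt X (\<epsilon> C A) = A"
  using ev_hom[OF assms] by (simp_all add: hom_def)

lemma unlam_lam: "\<lbrakk>C \<in> Ob X; A \<in> Ob X; f \<in> hom X (C \<times>\<^sub>o A) B\<rbrakk> \<Longrightarrow> \<Lambda>inv C B (\<Lambda> C A f) = f"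
  by (simp add: unlam_def lam_ev)

text \<open>
  Beta reduction at generalized elements.
\<close>

lemma lam_at:
  assumes "C \<in> Ob X" "A \<in> Ob X" "f \<in> hom X (C \<times>\<^sub>o A) B" "c \<in> hom X Z C" "x \<in> hom X Z A"
  shows "\<langle>c, x \<cdot> \<Lambda> C A f\<rangle> \<cdot> \<epsilon> C B = \<langle>c, x\<rangle> \<cdot> f"
proof -
  note [simp] = assms(1,2) homD[OF assms(3)] homD[OF assms(4)] homD[OF assms(5)]
    homD[OF lam_hom[OF assms(1-3)]]
  have [simp]: "B \<in> Ob X" using tgt_Ob[of f] by simp
  have "\<langle>c, x\<rangle> \<cdot> ((\<one> C \<times>\<^sub>m \<Lambda> C A f) \<cdot> \<epsilon> C B) = \<langle>c, x\<rangle> \<cdot> f"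
    by (simp add: lam_ev[OF assms(1-3)])
  then show ?thesis by (simp add: calc ev_typing ihom_Ob)
qed

lemma lam_ev_idn: "\<lbrakk>C \<in> Ob X; A \<in> Ob X\<rbrakk> \<Longrightarrow> \<Lambda> C (C \<Rrightarrow> A) (\<epsilon> C A) = \<one> (C \<Rrightarrow> A)"
  by (rule lam_unique[symmetric, OF _ _ ev_hom])
    (simp_all add: ihom_Ob idn_hom calc ev_typing)

end

context closed_linearizing_system
begin

lemma L_eq_unlam:
  assumes "C \<in> Ob X" "A \<in> Ob X" "f \<in> hom X (C \<times>\<^sub>o A) B"
  shows "L C A f = \<Lambda>inv C B (L0 (\<Lambda> C A f))"
  by (simp add: L_lambda[OF assms] unlam_lam[OF assms(1,2) LS_hom[OF assms]])

text \<open>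
  Evaluation is the uncurried identity, and the identity is linear.
\<close>

lemma L_ev:
  assumes [simp]: "C \<in> Ob X" "A \<in> Ob X"
  shows "L C (C \<Rrightarrow> A) (\<epsilon> C A) = \<epsilon> C A"
proof -
  have "L0 (\<one> (C \<Rrightarrow> A)) = \<one> (C \<Rrightarrow> A)"
    using linearizing_combinator.L3_idn[OF linearizing_combinator_L0] by (simp add: ihom_Ob)
  then show ?thesis
    using L_eq_unlam[OF _ _ ev_hom[of C A]] unlam_lam[OF _ _ ev_hom[of C A]]
    by (simp add: lam_ev_idn ihom_Ob)
qed

text \<open>
  By \<open>L_lambda\<close> each axiom becomes an equation about L_C.  For \<mu> and [f,g] it holds since evaluation
  is linear; commutation of the two partial linearizations is \<open>LS7\<close> for the parameter object \<top>,
  transported along \<pi>_1 : \<top> \<times> (A \<times> B) \<rightarrow> A \<times> B.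
\<close>

lemma exponentiable_L0: "exponentiable_linearizing_combinator X L0"
proof -
  interpret I: linearizing_combinator X L0 by (rule linearizing_combinator_L0)
  show ?thesis
  proof unfold_locales
    fix C A assume [simp]: "C \<in> Ob X" "A \<in> Ob X"
    show "L0 (eta X C A) = eta X C A"
      by (simp add: eta_def L_lambda[OF _ _ prj1_hom] LS3_idn)
    have "L C (C \<Rrightarrow> C \<Rrightarrow> A) (\<langle>\<pi>\<^sub>0 C (C \<Rrightarrow> C \<Rrightarrow> A), \<epsilon> C (C \<Rrightarrow> A)\<rangle> \<cdot> \<epsilon> C A) =
        \<langle>\<pi>\<^sub>0 C (C \<Rrightarrow> C \<Rrightarrow> A), \<epsilon> C (C \<Rrightarrow> A)\<rangle> \<cdot> \<epsilon> C A"
      using L_precomp_linear[of C "C \<Rrightarrow> C \<Rrightarrow> A" "\<epsilon> C (C \<Rrightarrow> A)" "C \<Rrightarrow> A" "\<epsilon> C A" A]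
      by (simp add: L_ev ev_hom ihom_Ob)
    then show "L0 (mu X C A) = mu X C A"
      unfolding mu_def
      by (subst L_lambda[where B=A]) (simp_all add: hom_def typing ev_typing ihom_Ob)
  next
    fix f g C D A B assume f: "f \<in> hom X C D" and g: "g \<in> hom X A B"
    note [simp] = homD[OF f] homD[OF g]
    have [simp]: "C \<in> Ob X" "D \<in> Ob X" "A \<in> Ob X" "B \<in> Ob X"
      using src_Ob[of f] tgt_Ob[of f] src_Ob[of g] tgt_Ob[of g] by simp_all
    note [simp] = ihom_Ob ev_typing L0_typing
    let ?H = "D \<Rrightarrow> A"
    have "L C ?H ((f \<times>\<^sub>m \<one> ?H) \<cdot> (\<epsilon> D A \<cdot> g)) = (f \<times>\<^sub>m \<one> ?H) \<cdot> L D ?H (\<epsilon> D A \<cdot> g)"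
      by (rule LS8[symmetric, where B=B]) (simp_all add: f, simp add: hom_def typing)
    \<comment> \<open>Seen with the parameter in D, g is applied to the linear inner map \<epsilon>.\<close>
    also have "\<epsilon> D A \<cdot> g = \<langle>\<pi>\<^sub>0 D ?H, \<epsilon> D A\<rangle> \<cdot> (\<pi>\<^sub>1 D A \<cdot> g)"
      by (simp add: calc)
    also have "L D ?H \<dots> = \<langle>\<pi>\<^sub>0 D ?H, \<epsilon> D A\<rangle> \<cdot> L D A (\<pi>\<^sub>1 D A \<cdot> g)"
      by (rule L_precomp_linear[where B'=B]) (simp_all add: L_ev ev_hom, simp add: hom_def typing)
    also have "\<dots> = \<epsilon> D A \<cdot> L0 g"
      by (simp add: L_prj1[OF _ g] calc)
    finally have "L C ?H ((f \<times>\<^sub>m \<one> ?H) \<cdot> \<epsilon> D A \<cdot> g) = (f \<times>\<^sub>m \<one> ?H) \<cdot> \<epsilon> D A \<cdot> L0 g"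
      by (simp add: calc)
    then show "L0 (ihom_map X f g) = ihom_map X f (L0 g)"
      unfolding ihom_map_def Let_def
      by (simp, subst L_lambda[where B=B]) (simp_all add: hom_def calc)
  next
    fix A B f C
    assume A [simp]: "A \<in> Ob X" and B [simp]: "B \<in> Ob X" and f: "f \<in> hom X (A \<times>\<^sub>o B) C"
    have snd_eq: "L_snd X L0 A B g = L A B g" if "g \<in> hom X (A \<times>\<^sub>o B) C" for g
      using L_eq_unlam[OF _ _ that] homD[OF that] by (simp add: L_snd_def)
    have fst_eq: "L_fst X L0 A B g = swap X A B \<cdot> L B A (swap X B A \<cdot> g)"
      if "g \<in> hom X (A \<times>\<^sub>o B) C" for g
    proof -
      have "swap X B A \<cdot> g \<in> hom X (B \<times>\<^sub>o A) C"
        using homD[OF that] by (simp add: swap_def hom_def typing)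
      from L_eq_unlam[OF _ _ this] homD[OF that] show ?thesis by (simp add: L_fst_def)
    qed
    have snd: "LS_snd X L \<top> A B (\<pi>\<^sub>1 \<top> (A \<times>\<^sub>o B) \<cdot> g) = \<pi>\<^sub>1 \<top> (A \<times>\<^sub>o B) \<cdot> L_snd X L0 A B g"
      if g: "g \<in> hom X (A \<times>\<^sub>o B) C" for g
      using L_at_reindex[of A B g C "\<pi>\<^sub>1 \<top> A" "\<top> \<times>\<^sub>o A"] homD[OF g]
      unfolding snd_eq[OF g] LS_snd_def inverse_alpha[OF trm_Ob A B]
      by (simp add: alpha_def g calc prj1_hom L_typing)
    have fst: "LS_fst X L \<top> A B (\<pi>\<^sub>1 \<top> (A \<times>\<^sub>o B) \<cdot> g) = \<pi>\<^sub>1 \<top> (A \<times>\<^sub>o B) \<cdot> L_fst X L0 A B g"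
      if g: "g \<in> hom X (A \<times>\<^sub>o B) C" for g
    proof -
      have "swap X B A \<cdot> g \<in> hom X (B \<times>\<^sub>o A) C"
        using homD[OF that] by (simp add: swap_def hom_def typing)
      from L_at_reindex[OF _ _ this, of "\<pi>\<^sub>1 \<top> B" "\<top> \<times>\<^sub>o B"] homD[OF g]
      show ?thesis
        unfolding fst_eq[OF g] LS_fst_def inverse_beta[OF trm_Ob A B]
        by (simp add: beta_def swap_def calc prj1_hom L_typing)
    qed
    have f0: "L_fst X L0 A B f \<in> hom X (A \<times>\<^sub>o B) C" and f1: "L_snd X L0 A B f \<in> hom X (A \<times>\<^sub>o B) C"
      using homD[OF f] by (simp_all add: fst_eq[OF f] snd_eq[OF f] swap_def hom_def typing L_typing)
    have "\<pi>\<^sub>1 \<top> (A \<times>\<^sub>o B) \<cdot> L_fst X L0 A B (L_snd X L0 A B f) =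
        \<pi>\<^sub>1 \<top> (A \<times>\<^sub>o B) \<cdot> L_snd X L0 A B (L_fst X L0 A B f)"
      unfolding fst[OF f1, symmetric] snd[OF f0, symmetric]
      unfolding fst[OF f, symmetric] snd[OF f, symmetric]
      by (rule LS7[symmetric, where D=C])
        (use homD[OF f] in \<open>simp_all add: hom_def typing\<close>)
    \<comment> \<open>The projection from \<top> \<times> (A \<times> B) is cancelled by its section \<langle>0, 1\<rangle>.\<close>
    then have "\<langle>\<zero> (A \<times>\<^sub>o B) \<top>, \<one> (A \<times>\<^sub>o B)\<rangle> \<cdot> (\<pi>\<^sub>1 \<top> (A \<times>\<^sub>o B) \<cdot> L_fst X L0 A B (L_snd X L0 A B f)) =
        \<langle>\<zero> (A \<times>\<^sub>o B) \<top>, \<one> (A \<times>\<^sub>o B)\<rangle> \<cdot> (\<pi>\<^sub>1 \<top> (A \<times>\<^sub>o B) \<cdot> L_snd X L0 A B (L_fst X L0 A B f))"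
      by simp
    moreover have "L_fst X L0 A B (L_snd X L0 A B f) \<in> hom X (A \<times>\<^sub>o B) C"
      "L_snd X L0 A B (L_fst X L0 A B f) \<in> hom X (A \<times>\<^sub>o B) C"
      using homD[OF f0] homD[OF f1]
      by (simp_all add: fst_eq[OF f1] snd_eq[OF f0] swap_def hom_def typing L_typing)
    ultimately show "L_fst X L0 A B (L_snd X L0 A B f) = L_snd X L0 A B (L_fst X L0 A B f)"
      by (simp add: hom_def calc)
  qed
qed

text \<open>
  With h(a,v) in an exponential, linearizing h(a,v)(c) in v with parameters (c,a) amounts to
  linearizing h in v and then evaluating at c, since evaluation at c is a linear outer function.
\<close>

lemma L_ev_postcomp:
  assumes [simp]: "C \<in> Ob X" "A \<in> Ob X" "V \<in> Ob X" "B \<in> Ob X" and h: "h \<in> hom X (A \<times>\<^sub>o V) (C \<Rrightarrow> B)"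
  defines "P \<equiv> C \<times>\<^sub>o A"
  defines "p \<equiv> \<langle>\<pi>\<^sub>0 P V \<cdot> \<pi>\<^sub>1 C A, \<pi>\<^sub>1 P V\<rangle>"
  shows "L P V (\<langle>\<pi>\<^sub>0 P V \<cdot> \<pi>\<^sub>0 C A, p \<cdot> h\<rangle> \<cdot> \<epsilon> C B) = \<langle>\<pi>\<^sub>0 P V \<cdot> \<pi>\<^sub>0 C A, p \<cdot> L A V h\<rangle> \<cdot> \<epsilon> C B"
proof -
  note [simp] = homD[OF h] ihom_Ob ev_typing L_typing
  have P [simp]: "P \<in> Ob X" by (simp add: P_def typing)
  let ?H = "C \<Rrightarrow> B"
  let ?e = "\<langle>\<pi>\<^sub>0 P ?H \<cdot> \<pi>\<^sub>0 C A, \<pi>\<^sub>1 P ?H\<rangle> \<cdot> \<epsilon> C B"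
  have "L P ?H ?e = ?e"
    using L_at_reindex[OF _ _ ev_hom, of C B "\<pi>\<^sub>0 C A" P] by (simp add: L_ev P_def prj0_hom)
  then have "L P V (\<langle>\<pi>\<^sub>0 P V, p \<cdot> h\<rangle> \<cdot> ?e) = \<langle>\<pi>\<^sub>0 P V, L P V (p \<cdot> h)\<rangle> \<cdot> ?e"
    by (intro L_postcomp_linear[where B'=B]) (simp_all add: p_def P_def hom_def typing)
  also have "L P V (p \<cdot> h) = p \<cdot> L A V h"
    unfolding p_def
    by (rule L_at_reindex[OF _ _ h]) (simp_all add: P_def prj1_hom)
  finally show ?thesis by (simp add: p_def P_def calc)
qed

text \<open>
  For h(a,v) = \<lambda>(f)(a + v), \<open>L_ev_postcomp\<close> says that evaluating D[\<lambda>(f)](a,v) at c gives the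
  linearization of f(c, a + v) in v.  That is the derivative of f at (c,a) along the linear direction
  (0,v), hence D_C[f].
\<close>

lemma DL_lam:
  assumes [simp]: "C \<in> Ob X" "A \<in> Ob X" "B \<in> Ob X" and f: "f \<in> hom X (C \<times>\<^sub>o A) B"
  shows "DL (\<Lambda> C A f) = \<Lambda> C (A \<times>\<^sub>o A) (partial_D X DL C A f)"
proof -
  have lf: "\<Lambda> C A f \<in> hom X A (C \<Rrightarrow> B)" by (rule lam_hom[OF _ _ f]) simp_all
  note [simp] = homD[OF f] homD[OF lf] ihom_Ob ev_typing DL_typing
  let ?P = "C \<times>\<^sub>o A" and ?A2 = "A \<times>\<^sub>o A"
  let ?c = "\<pi>\<^sub>0 ?P A \<cdot> \<pi>\<^sub>0 C A" and ?a = "\<pi>\<^sub>0 ?P A \<cdot> \<pi>\<^sub>1 C A" and ?v = "\<pi>\<^sub>1 ?P A"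
  have "L ?P A (\<langle>?c, \<langle>?a, ?v\<rangle> \<cdot> (\<oplus> A \<cdot> \<Lambda> C A f)\<rangle> \<cdot> \<epsilon> C B) =
      \<langle>?c, \<langle>?a, ?v\<rangle> \<cdot> DL (\<Lambda> C A f)\<rangle> \<cdot> \<epsilon> C B"
    unfolding DL_eq[OF lf] by (rule L_ev_postcomp) (simp_all add: hom_def codiag_def typing)
  also have "\<langle>?c, \<langle>?a, ?v\<rangle> \<cdot> (\<oplus> A \<cdot> \<Lambda> C A f)\<rangle> \<cdot> \<epsilon> C B = \<langle>?c, ?a \<^bold>+ ?v\<rangle> \<cdot> f"
    using lam_at[OF _ _ f, of ?c "?P \<times>\<^sub>o A" "?a \<^bold>+ ?v"] by (simp add: hom_def calc)
  also have "\<dots> = (\<pi>\<^sub>0 ?P A \<^bold>+ \<langle>\<zero> (?P \<times>\<^sub>o A) C, ?v\<rangle>) \<cdot> f"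
  proof -
    have "\<langle>?c, ?a \<^bold>+ ?v\<rangle> = \<pi>\<^sub>0 ?P A \<^bold>+ \<langle>\<zero> (?P \<times>\<^sub>o A) C, ?v\<rangle>"
      by (rule pairing_ext[of C A]) (simp_all add: calc)
    then show ?thesis by simp
  qed
  also have "L ?P A \<dots> = \<langle>\<pi>\<^sub>0 ?P A, \<langle>\<zero> (?P \<times>\<^sub>o A) C, ?v\<rangle>\<rangle> \<cdot> DL f"
    by (rule DL_along_linear[OF f, symmetric])
      (simp_all add: L_injections prd_Ob, simp add: hom_def typing)
  \<comment> \<open>\<open>alpha\<close> rebrackets (C \<times> A) \<times> A, the source of the linearization, as C \<times> (A \<times> A).\<close>
  finally have "alpha X C A A \<cdot> (\<langle>?c, \<langle>?a, ?v\<rangle> \<cdot> DL (\<Lambda> C A f)\<rangle> \<cdot> \<epsilon> C B) =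
      alpha X C A A \<cdot> (\<langle>\<pi>\<^sub>0 ?P A, \<langle>\<zero> (?P \<times>\<^sub>o A) C, ?v\<rangle>\<rangle> \<cdot> DL f)"
    by simp
  then have "(\<one> C \<times>\<^sub>m DL (\<Lambda> C A f)) \<cdot> \<epsilon> C B = partial_D X DL C A f"
    by (simp add: alpha_def partial_D_def calc)
  then show ?thesis
    by (intro lam_unique[where B=B]) (simp_all add: partial_D_def hom_def calc)
qed

lemma CD_lambda_DL: "CD_lambda X DL"
  unfolding CD_lambda_def by (blast intro: DL_lam)

text \<open>
  \<open>CD_lambda\<close> applied to \<lambda>(\<epsilon>) = 1, whose derivative is \<pi>_1.
\<close>

lemma CD_ev_DL: "CD_ev X DL"
  unfolding CD_ev_def
proof (intro ballI)
  fix C A assume [simp]: "C \<in> Ob X" "A \<in> Ob X"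
  let ?H = "C \<Rrightarrow> A"
  note [simp] = ihom_Ob ev_typing DL_typing
  have "partial_D X DL C ?H (\<epsilon> C A) \<in> hom X (C \<times>\<^sub>o (?H \<times>\<^sub>o ?H)) A"
    by (simp add: partial_D_def hom_def calc)
  then have "partial_D X DL C ?H (\<epsilon> C A) =
      (\<one> C \<times>\<^sub>m \<Lambda> C (?H \<times>\<^sub>o ?H) (partial_D X DL C ?H (\<epsilon> C A))) \<cdot> \<epsilon> C A"
    by (simp add: lam_ev prd_Ob)
  also have "\<Lambda> C (?H \<times>\<^sub>o ?H) (partial_D X DL C ?H (\<epsilon> C A)) = DL (\<Lambda> C ?H (\<epsilon> C A))"
    by (rule DL_lam[symmetric, OF _ _ _ ev_hom]) simp_all
  also have "\<dots> = \<pi>\<^sub>1 ?H ?H"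
    by (simp add: lam_ev_idn differential_combinator.CD3_idn[OF differential_combinator_DL])
  finally show "partial_D X DL C ?H (\<epsilon> C A) = (\<one> C \<times>\<^sub>m \<pi>\<^sub>1 ?H ?H) \<cdot> \<epsilon> C A" .
qed

lemma DL_eq_unlam:
  assumes f: "f \<in> hom X A B"
  shows "DL f = \<Lambda>inv A B (L0 (\<Lambda> A A (\<oplus> A \<cdot> f)))"
proof -
  note [simp] = homD[OF f]
  have [simp]: "A \<in> Ob X" using src_Ob[of f] by simp
  show ?thesis
    unfolding DL_eq[OF f] by (rule L_eq_unlam) (simp_all add: hom_def calc)
qed

lemma cc_differential_category_DL: "cc_differential_category X DL"
  by (intro cc_differential_category.intro differential_combinator_DL
      cc_differential_category_axioms.intro CD_lambda_DL cc_left_additive_category_axioms)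

end

theorem proposition6p9:
  fixes X :: "('o, 'a, 'm) cc_ladd_cat_scheme" (structure)
    and L :: "'o \<Rightarrow> 'o \<Rightarrow> 'a \<Rightarrow> 'a"
  assumes "cc_left_additive_category X"
    and "closed_linearizing_system X L"
  shows "(exponentiable_linearizing_combinator X (induced_L X L) \<and>
          (\<forall>C\<in>Ob X. \<forall>A\<in>Ob X. \<forall>B\<in>Ob X. \<forall>f\<in>hom X (C \<times>\<^sub>o A) B.
             L C A f = \<Lambda>inv C B (induced_L X L (\<Lambda> C A f)))) \<and>
         (differential_combinator X (induced_D X L) \<and>
          CD_lambda X (induced_D X L) \<and>
          CD_ev X (induced_D X L) \<and>
          (\<forall>A\<in>Ob X. \<forall>B\<in>Ob X. \<forall>f\<in>hom X A B.
             induced_D X L f = \<Lambda>inv A B (induced_L X L (\<Lambda> A A (\<oplus> A \<cdot> f))))) \<and>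
         cc_differential_category X (induced_D X L)"
proof -
  interpret closed_linearizing_system X L by (rule assms(2))
  show ?thesis
    using exponentiable_L0 L_eq_unlam differential_combinator_DL CD_lambda_DL CD_ev_DL
      DL_eq_unlam cc_differential_category_DL
    by blast
qed

end
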